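(* Let $\lambda,\mu,T>0$. For every probability measure $f_0\in\mathcal{M}$ there is a unique $f\in C([0,\infty),\mathcal{M})$ such that for all $t\ge 0$ $$f_t=e^{-(2\lambda+\mu)t}f_0+\int_0^t e^{-(2\lambda+\mu)(t-s)}\big(2\lambda B[f_s,f_s]+\mu B[f_s,\gamma]\big)\,ds.$$ Moreover, $f_t$ is a probability measure for every $t\ge0$. If $f_0$ has a density (with respect to Lebesgue measure), then so does $f_t$ for all $t\geq 0$; and if $f_0$ has a finite $r$-th moment $\int_{\mathbb{R}}|v|^r f_0(dv)<\infty$ for some $r\ge2$, then so does $f_t$ for all $t\ge0$.
   Context: $\mathcal{M}$ is the space of bounded non-negative Borel measures on $\mathbb{R}$, metrized by total variation $\|\cdot\|$. $\gamma(w)=(2\pi T)^{-1/2}e^{-w^2/(2T)}$ is the centered Gaussian density with variance $T$, identified with the corresponding probability measure. For $\nu_1,\nu_2\in\mathcal{M}$, the measure $B[\nu_1,\nu_2]\in\mathcal{M}$ is defined by $$\int_{\mathbb{R}}\phi(x)\,B[\nu_1,\nu_2](dx)=\int_{\mathbb{R}}\int_{\mathbb{R}}\nu_1(dx)\,\nu_2(dy)\int_0^{2\pi}\phi(x\cos\theta+y\sin\theta)\frac{d\theta}{2\pi}$$ for all bounded continuous $\phi:\mathbb{R}\to\mathbb{R}$. The integral equation in the claim is an equivalent (mild) form of the weak formulation $f_t=f_0+\int_0^t\{2\lambda(B[f_s,f_s]-f_s)+\mu(B[f_s,\gamma]-f_s)\}\,ds$, $t\ge0$, of the thermostated Boltzmann-Kac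 equation; a function $f\in C([0,\infty),\mathcal{M})$ satisfying the latter is called a weak solution with initial condition $f_0$. *)

theory Defs
  imports "HOL-Probability.Probability"
begin

text \<open>
  The library locale \<^locale>\<open>finite_borel_measure\<close> (a finite measure on the Borel sets of the
  real line) describes the elements of the space of measures.  The total variation norm of a
  difference of two such measures is the supremum, over finite Borel partitions of the line, of
  the sum of the absolute values; for finite measures that supremum is bounded by the sum of the
  two total masses.
\<close>

definition tv_dist :: "real measure \<Rightarrow> real measure \<Rightarrow> real" where
  "tv_dist \<mu> \<nu> = (SUP P \<in> {P. finite P \<and> P \<subseteq> sets borel \<and> partition_on UNIV P}.
     \<Sum>A\<in>P. \<bar>measure \<mu> A - measure \<nu> A\<bar>)"

text \<open>
  Curves are extensional (\<^const>\<open>undefined\<close> at negative times), so that equality in this set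
  is equality on the half-line.
\<close>

definition tv_continuous_curves :: "(real \<Rightarrow> real measure) set" where
  "tv_continuous_curves =
     {f \<in> {0..} \<rightarrow>\<^sub>E {\<nu>. finite_borel_measure \<nu>}.
        \<forall>t\<ge>0. ((\<lambda>s. tv_dist (f s) (f t)) \<longlongrightarrow> 0) (at t within {0..})}"

definition gaussian :: "real \<Rightarrow> real measure" where
  "gaussian T = density lborel (normal_density 0 (sqrt T))"

definition is_collision :: "real measure \<Rightarrow> real measure \<Rightarrow> real measure \<Rightarrow> bool" where
  "is_collision \<nu>\<^sub>1 \<nu>\<^sub>2 \<beta> \<longleftrightarrow> finite_borel_measure \<beta> \<and>
     (\<forall>\<phi>::real \<Rightarrow> real. continuous_on UNIV \<phi> \<and> bounded (range \<phi>) \<longrightarrow>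
        (LINT x|\<beta>. \<phi> x) =
        (LINT x|\<nu>\<^sub>1. (LINT y|\<nu>\<^sub>2. (LINT \<theta>:{0..2*pi}|lborel.
            \<phi> (x * cos \<theta> + y * sin \<theta>) / (2*pi)))))"

definition collision :: "real measure \<Rightarrow> real measure \<Rightarrow> real measure" where
  "collision \<nu>\<^sub>1 \<nu>\<^sub>2 = (THE \<beta>. is_collision \<nu>\<^sub>1 \<nu>\<^sub>2 \<beta>)"

text \<open>
  The identity between measures is required on every Borel set, the integral of a curve of
  measures being the measure whose value at \<open>A\<close> is the integral of the values at \<open>A\<close>.  For \<open>f\<close>
  continuous in total variation the integrand is continuous in total variation too, so this is
  the same as the Riemann integral in the Banach space of finite signed measures.
\<close>

definition mild_solution ::
  "real \<Rightarrow> real \<Rightarrow> real \<Rightarrow> real measure \<Rightarrow> (real \<Rightarrow> real measure) \<Rightarrow> bool" where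
  "mild_solution lam mu T f\<^sub>0 f \<longleftrightarrow>
     (\<forall>t\<ge>0. \<forall>A\<in>sets borel.
        measure (f t) A =
          exp (- (2*lam + mu) * t) * measure f\<^sub>0 A +
          (LINT s:{0..t}|lborel. exp (- (2*lam + mu) * (t - s)) *
             (2 * lam * measure (collision (f s) (f s)) A +
              mu * measure (collision (f s) (gaussian T)) A)))"

definition has_lebesgue_density :: "real measure \<Rightarrow> bool" where
  "has_lebesgue_density \<nu> \<longleftrightarrow> (\<exists>\<rho>\<in>borel_measurable lborel. \<nu> = density lborel \<rho>)"

definition finite_moment :: "real \<Rightarrow> real measure \<Rightarrow> bool" where
  "finite_moment r \<nu> \<longleftrightarrow> integrable \<nu> (\<lambda>v. \<bar>v\<bar> powr r)"

text \<open>The collision measure exists and is unique, so \<^const>\<open>collision\<close> is well defined.\<close>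

lemma finite_borel_measure_eqI:
  assumes M: "finite_borel_measure M" and N: "finite_borel_measure N"
    and eq: "\<And>\<phi>::real \<Rightarrow> real. continuous_on UNIV \<phi> \<Longrightarrow> bounded (range \<phi>) \<Longrightarrow>
               (LINT x|M. \<phi> x) = (LINT x|N. \<phi> x)"
  shows "M = N"
proof (rule cdf_unique'[OF M N], rule ext)
  fix a :: real
  let ?g = "\<lambda>n x. cts_step a (a + 1 / real (Suc n)) x"
  have lim: "(\<lambda>n. LINT x|K. ?g n x) \<longlonglongrightarrow> cdf K a" if K: "finite_borel_measure K" for K
  proof -
    interpret K: finite_borel_measure K by fact
    have meas: "h \<in> borel_measurable borel \<Longrightarrow> h \<in> borel_measurable K" for h :: "real \<Rightarrow> real"
      by (simp add: measurable_cong_sets[OF K.M_is_borel refl])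
    have "(\<lambda>n. LINT x|K. ?g n x) \<longlonglongrightarrow> (LINT x|K. indicator {..a} x)"
    proof (rule integral_dominated_convergence[where w="\<lambda>_. 1"])
      show "(indicator {..a} :: real \<Rightarrow> real) \<in> borel_measurable K"
        by (rule meas) simp
      show "?g n \<in> borel_measurable K" for n
        by (rule meas, rule borel_measurable_continuous_onI,
            rule uniformly_continuous_imp_continuous, rule cts_step_uniformly_continuous) simp
      show "AE x in K. (\<lambda>n. ?g n x) \<longlonglongrightarrow> indicator {..a} x"
      proof (rule AE_I2)
        fix x
        show "(\<lambda>n. ?g n x) \<longlonglongrightarrow> indicator {..a} x"
        proof (cases "x \<le> a")
          case True
          then show ?thesis by (simp add: cts_step_def)
        next
          case False
          have "(\<lambda>n. a + 1 / real (Suc n)) \<longlonglongrightarrow> a + 0"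
            by (intro tendsto_intros LIMSEQ_Suc[OF lim_1_over_n])
          then have "eventually (\<lambda>n. a + 1 / real (Suc n) < x) sequentially"
            using False by (intro order_tendstoD(2)[of _ a]) auto
          then have "eventually (\<lambda>n. ?g n x = indicator {..a} x) sequentially"
            by eventually_elim (use False in \<open>auto simp: cts_step_def\<close>)
          then show ?thesis by (rule tendsto_eventually)
        qed
      qed
      show "AE x in K. norm (?g n x) \<le> 1" for n
        by (rule AE_I2) (auto simp: cts_step_def divide_simps)
    qed simp
    moreover have "(LINT x|K. indicator {..a} x) = cdf K a"
      by (simp add: cdf_def K.borel_UNIV)
    ultimately show ?thesis by simp
  qed
  have "(LINT x|M. ?g n x) = (LINT x|N. ?g n x)" for n
  proof (rule eq)
    show "continuous_on UNIV (?g n)"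
      by (rule uniformly_continuous_imp_continuous, rule cts_step_uniformly_continuous) simp
    show "bounded (range (?g n))"
      by (rule boundedI[of _ 1]) (auto simp: cts_step_def divide_simps)
  qed
  with lim[OF M] lim[OF N] show "cdf M a = cdf N a"
    using LIMSEQ_unique by simp
qed

lemma ex1_collision:
  assumes "finite_borel_measure \<nu>\<^sub>1" "finite_borel_measure \<nu>\<^sub>2"
  shows "\<exists>!\<beta>. is_collision \<nu>\<^sub>1 \<nu>\<^sub>2 \<beta>"
proof -
  interpret N1: finite_borel_measure \<nu>\<^sub>1 by fact
  interpret N2: finite_borel_measure \<nu>\<^sub>2 by fact
  define U where "U = density lborel (\<lambda>\<theta>::real. ennreal (indicator {0..2*pi} \<theta> / (2*pi)))"
  have U_meas[measurable_cong]: "sets U = sets borel"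
    by (simp add: U_def)
  note [measurable_cong] = N1.M_is_borel N2.M_is_borel
  have U_lint: "(LINT \<theta>|U. h \<theta>) = (LINT \<theta>:{0..2*pi}|lborel. h \<theta> / (2*pi))"
    if "h \<in> borel_measurable borel" for h :: "real \<Rightarrow> real"
    unfolding U_def set_lebesgue_integral_def
    by (subst integral_density) (use that in \<open>auto intro!: Bochner_Integration.integral_cong\<close>)
  have "(\<integral>\<^sup>+ \<theta>. ennreal (indicator {0..2*pi} \<theta> / (2*pi)) \<partial>lborel)
      = (\<integral>\<^sup>+ \<theta>. ennreal (1 / (2*pi)) * indicator {0..2*pi} \<theta> \<partial>lborel)"
    by (intro nn_integral_cong) (auto simp: indicator_def)
  then have "emeasure U (space U) < \<infinity>"
    by (simp add: U_def emeasure_density ennreal_mult_less_top nn_integral_cmult)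
  then interpret U: finite_measure U
    by (intro finite_measureI) auto
  let ?P = "\<nu>\<^sub>2 \<Otimes>\<^sub>M U"
  interpret P: finite_measure ?P
    by (rule finite_measure_pair_measure) unfold_locales
  let ?Q = "\<nu>\<^sub>1 \<Otimes>\<^sub>M ?P"
  interpret Q: finite_measure ?Q
    by (rule finite_measure_pair_measure) unfold_locales
  interpret PQ: pair_sigma_finite \<nu>\<^sub>1 ?P by unfold_locales
  interpret PP: pair_sigma_finite \<nu>\<^sub>2 U by unfold_locales
  let ?h = "\<lambda>(x, y, \<theta>). x * cos \<theta> + y * sin \<theta> :: real"
  have h[measurable]: "?h \<in> ?Q \<rightarrow>\<^sub>M borel" by measurable
  define \<beta> where "\<beta> = distr ?Q borel ?h"
  have fin: "finite_borel_measure \<beta>"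
    unfolding \<beta>_def finite_borel_measure_def finite_borel_measure_axioms_def
    using Q.finite_measure_distr[OF h] by simp
  have "(LINT x|\<beta>. \<phi> x) = (LINT x|\<nu>\<^sub>1. (LINT y|\<nu>\<^sub>2. (LINT \<theta>:{0..2*pi}|lborel.
            \<phi> (x * cos \<theta> + y * sin \<theta>) / (2*pi))))"
    if c: "continuous_on UNIV \<phi>" and b: "bounded (range \<phi>)" for \<phi> :: "real \<Rightarrow> real"
  proof -
    have [measurable]: "\<phi> \<in> borel_measurable borel"
      by (rule borel_measurable_continuous_onI[OF c])
    obtain C where C: "\<And>x. norm (\<phi> x) \<le> C"
      using b by (auto simp: bounded_iff)
    have iQ: "integrable ?Q (\<lambda>(x, y, \<theta>). \<phi> (x * cos \<theta> + y * sin \<theta>))"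
      by (rule Q.integrable_const_bound[of _ C]) (use C in auto)
    have iP: "integrable ?P (\<lambda>(y, \<theta>). \<phi> (x * cos \<theta> + y * sin \<theta>))" for x
      by (rule P.integrable_const_bound[of _ C]) (use C in auto)
    have "(LINT x|\<beta>. \<phi> x) = (LINT z|?Q. \<phi> (?h z))"
      unfolding \<beta>_def by (rule integral_distr[OF h]) measurable
    also have "\<dots> = (LINT z|?Q. (\<lambda>(x, w). (\<lambda>(y, \<theta>). \<phi> (x * cos \<theta> + y * sin \<theta>)) w) z)"
      by (intro Bochner_Integration.integral_cong) auto
    also have "\<dots> = (LINT x|\<nu>\<^sub>1. (LINT w|?P. (\<lambda>(y, \<theta>). \<phi> (x * cos \<theta> + y * sin \<theta>)) w))"
      using iQ by (subst PQ.integral_fst'[symmetric]) (auto simp: case_prod_unfold)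
    also have "\<dots> = (LINT x|\<nu>\<^sub>1. (LINT y|\<nu>\<^sub>2. (LINT \<theta>|U. \<phi> (x * cos \<theta> + y * sin \<theta>))))"
      by (intro Bochner_Integration.integral_cong refl, subst PP.integral_fst'[symmetric])
         (use iP in \<open>auto simp: case_prod_unfold\<close>)
    also have "\<dots> = (LINT x|\<nu>\<^sub>1. (LINT y|\<nu>\<^sub>2. (LINT \<theta>:{0..2*pi}|lborel.
            \<phi> (x * cos \<theta> + y * sin \<theta>) / (2*pi))))"
      by (intro Bochner_Integration.integral_cong refl U_lint) measurable
    finally show ?thesis .
  qed
  with fin have "is_collision \<nu>\<^sub>1 \<nu>\<^sub>2 \<beta>"
    by (auto simp: is_collision_def)
  then show ?thesis
  proof (rule ex1I)
    fix \<beta>' assume "is_collision \<nu>\<^sub>1 \<nu>\<^sub>2 \<beta>'"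
    with \<open>is_collision \<nu>\<^sub>1 \<nu>\<^sub>2 \<beta>\<close> show "\<beta>' = \<beta>"
      unfolding is_collision_def by (intro finite_borel_measure_eqI) auto
  qed
qed

end

theory Submission
  imports Defs
begin

text \<open>
  For probability measures the thermostat term can be absorbed into the collisions: with
  \<open>c = 2\<lambda> + \<mu>\<close>, the bilinear operation \<open>D[f, g] = (2\<lambda> B[f, g] + \<mu> B[f, \<gamma>]) / c\<close> maps pairs of
  probability measures to probability measures and the equation becomes \<open>f' = c (D[f, f] - f)\<close>.
  It is solved by Wild's sum
  \<open>f\<^sub>t = \<Sum>n. exp (-c t) (1 - exp (-c t))^n Q\<^sub>n\<close>, where \<open>Q\<^sub>0 = f\<^sub>0\<close> and \<open>Q\<^bsub>n+1\<^esub>\<close> is the average of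
  \<open>D[Q\<^sub>k, Q\<^bsub>n-k\<^esub>]\<close> over \<open>k \<le> n\<close>.  This is a mixture, with geometric weights, of probability
  measures that do not depend on time.  On a fixed Borel set the mild equation is the fundamental
  theorem of calculus for the power series with coefficients \<open>Q\<^sub>n(A)\<close>.  Each \<open>Q\<^sub>n\<close> has a density
  if \<open>f\<^sub>0\<close> has one, and the \<open>r\<close>-th moments of the \<open>Q\<^sub>n\<close> grow polynomially, hence are summable
  against the weights.  Uniqueness is Gronwall's argument, in the form of the bound
  \<open>M (L t)^n / n!\<close> for the difference of two solutions on any Borel set.
\<close>

section \<open>The collision operator\<close>

text \<open>Treating the uniform angle as a third, independent probability measure makes the
  collision the law of one random variable, so the angular average is handled by Tonelli like the
  other two integrals.\<close>

definition angle :: "real measure" where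
  "angle = density lborel (\<lambda>\<theta>. ennreal (indicator {0..2*pi} \<theta> / (2*pi)))"

lemma sets_angle [simp, measurable_cong]: "sets angle = sets borel"
  by (simp add: angle_def)

lemma space_angle [simp]: "space angle = UNIV"
  by (simp add: angle_def)

interpretation angle: prob_space angle
proof
  have "emeasure angle (space angle) = (\<integral>\<^sup>+\<theta>. ennreal (1 / (2*pi)) * indicator {0..2*pi} \<theta> \<partial>lborel)"
    unfolding angle_def by (subst emeasure_density) (auto intro!: nn_integral_cong simp: indicator_def)
  also have "\<dots> = 1"
    by (subst nn_integral_cmult) (auto simp flip: ennreal_mult)
  finally show "emeasure angle (space angle) = 1" .
qed

lemma integral_angle:
  fixes h :: "real \<Rightarrow> real"
  assumes "h \<in> borel_measurable borel"
  shows "(LINT \<theta>|angle. h \<theta>) = (LINT \<theta>:{0..2*pi}|lborel. h \<theta> / (2*pi))"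
  unfolding angle_def set_lebesgue_integral_def
  by (subst integral_density) (use assms in \<open>auto intro!: Bochner_Integration.integral_cong\<close>)

text \<open>For such angles \<open>x \<mapsto> x * cos \<theta> + d\<close> is an invertible affine
  map, which is what lets collisions inherit absolute continuity.\<close>

lemma AE_angle_cos: "AE \<theta> in angle. cos \<theta> \<noteq> 0"
proof -
  have "countable {\<theta>::real. cos \<theta> = 0}"
    by (rule countable_subset[of _ "range (\<lambda>i::int. of_int i * pi + pi/2)"])
       (auto simp: cos_zero_iff_int2)
  then have "{\<theta>::real. cos \<theta> = 0} \<in> null_sets lborel"
    by (rule countable_imp_null_set_lborel)
  from AE_not_in[OF this] have "AE \<theta>::real in lborel. cos \<theta> \<noteq> 0"
    by simp
  then show ?thesis
    unfolding angle_def by (subst AE_density) (auto elim: AE_mp)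
qed

text \<open>\<open>collision\<close> is a definite description; this explicit witness is what allows
  computing with it. Fubini applies because the test functions are bounded and all measures
  finite.\<close>

lemma is_collision_distr:
  assumes "finite_borel_measure f" "finite_borel_measure g"
  shows "is_collision f g
    (distr (f \<Otimes>\<^sub>M (g \<Otimes>\<^sub>M angle)) borel (\<lambda>(x, y, \<theta>). x * cos \<theta> + y * sin \<theta>))"
    (is "is_collision f g (distr ?Q borel ?h)")
proof -
  interpret f: finite_borel_measure f by fact
  interpret g: finite_borel_measure g by fact
  note [measurable_cong] = f.M_is_borel g.M_is_borel
  interpret P: finite_measure "g \<Otimes>\<^sub>M angle"
    by (rule finite_measure_pair_measure) unfold_locales
  interpret Q: finite_measure ?Q
    by (rule finite_measure_pair_measure) unfold_locales
  interpret PQ: pair_sigma_finite f "g \<Otimes>\<^sub>M angle" by unfold_locales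
  interpret PP: pair_sigma_finite g angle by unfold_locales
  have h[measurable]: "?h \<in> ?Q \<rightarrow>\<^sub>M borel" by measurable
  have "finite_borel_measure (distr ?Q borel ?h)"
    unfolding finite_borel_measure_def finite_borel_measure_axioms_def
    using Q.finite_measure_distr[OF h] by simp
  moreover have "(LINT x|distr ?Q borel ?h. \<phi> x) = (LINT x|f. (LINT y|g.
            (LINT \<theta>:{0..2*pi}|lborel. \<phi> (x * cos \<theta> + y * sin \<theta>) / (2*pi))))"
    if c: "continuous_on UNIV \<phi>" and b: "bounded (range \<phi>)" for \<phi> :: "real \<Rightarrow> real"
  proof -
    have [measurable]: "\<phi> \<in> borel_measurable borel"
      by (rule borel_measurable_continuous_onI[OF c])
    obtain C where C: "\<And>x. norm (\<phi> x) \<le> C"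
      using b by (auto simp: bounded_iff)
    have "(LINT x|distr ?Q borel ?h. \<phi> x) = (LINT z|?Q. \<phi> (?h z))"
      by (rule integral_distr[OF h]) measurable
    also have "\<dots> = (LINT x|f. (LINT w|(g \<Otimes>\<^sub>M angle). \<phi> (?h (x, w))))"
      by (rule PQ.integral_fst'[symmetric], rule Q.integrable_const_bound[of _ C])
         (use C in auto)
    also have "\<dots> = (LINT x|f. (LINT y|g. (LINT \<theta>|angle. \<phi> (?h (x, y, \<theta>)))))"
      by (intro Bochner_Integration.integral_cong refl PP.integral_fst'[symmetric]
          P.integrable_const_bound[of _ C]) (use C in auto)
    also have "\<dots> = (LINT x|f. (LINT y|g. (LINT \<theta>:{0..2*pi}|lborel.
            \<phi> (x * cos \<theta> + y * sin \<theta>) / (2*pi))))"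
      unfolding prod.case
      by (intro Bochner_Integration.integral_cong refl integral_angle) measurable
    finally show ?thesis .
  qed
  ultimately show ?thesis
    by (auto simp: is_collision_def)
qed

lemma collision_eq_distr:
  assumes "finite_borel_measure f" "finite_borel_measure g"
  shows "collision f g =
    distr (f \<Otimes>\<^sub>M (g \<Otimes>\<^sub>M angle)) borel (\<lambda>(x, y, \<theta>). x * cos \<theta> + y * sin \<theta>)"
  unfolding collision_def
  by (rule the1_equality[OF ex1_collision[OF assms] is_collision_distr[OF assms]])

lemma finite_borel_measure_collision:
  assumes "finite_borel_measure f" "finite_borel_measure g"
  shows "finite_borel_measure (collision f g)"
  using is_collision_distr[OF assms]
  unfolding collision_eq_distr[OF assms] is_collision_def by simp

text \<open>Passes from bounded continuous test functions to all nonnegative measurable ones, in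
  particular to indicators and to powers of the absolute value.\<close>

lemma nn_integral_collision:
  assumes "finite_borel_measure f" "finite_borel_measure g"
    and [measurable]: "\<phi> \<in> borel_measurable borel"
  shows "(\<integral>\<^sup>+z. \<phi> z \<partial>collision f g) =
    (\<integral>\<^sup>+x. \<integral>\<^sup>+y. \<integral>\<^sup>+\<theta>. \<phi> (x * cos \<theta> + y * sin \<theta>) \<partial>angle \<partial>g \<partial>f)"
proof -
  interpret f: finite_borel_measure f by fact
  interpret g: finite_borel_measure g by fact
  note [measurable_cong] = f.M_is_borel g.M_is_borel
  interpret P: finite_measure "g \<Otimes>\<^sub>M angle"
    by (rule finite_measure_pair_measure) unfold_locales
  show ?thesis
    unfolding collision_eq_distr[OF assms(1,2)]
    by (subst nn_integral_distr, measurable, subst P.nn_integral_fst[symmetric], measurable,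
        subst angle.nn_integral_fst[symmetric]) (auto simp: case_prod_unfold)
qed

text \<open>With \<open>f\<close> innermost, the other velocity and the angle are frozen, so
  information about \<open>f\<close> on affine preimages can be used pointwise and then
  averaged.\<close>

lemma nn_integral_collision_left:
  assumes "finite_borel_measure f" "finite_borel_measure g"
    and [measurable]: "\<phi> \<in> borel_measurable borel"
  shows "(\<integral>\<^sup>+z. \<phi> z \<partial>collision f g) =
    (\<integral>\<^sup>+y. \<integral>\<^sup>+\<theta>. \<integral>\<^sup>+x. \<phi> (x * cos \<theta> + y * sin \<theta>) \<partial>f \<partial>angle \<partial>g)"
proof -
  interpret f: finite_borel_measure f by fact
  interpret g: finite_borel_measure g by fact
  note [measurable_cong] = f.M_is_borel g.M_is_borel
  interpret fg: pair_sigma_finite f g by unfold_locales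
  interpret fa: pair_sigma_finite f angle by unfold_locales
  show ?thesis
    unfolding nn_integral_collision[OF assms]
    by (subst fg.Fubini'[symmetric], measurable, intro nn_integral_cong, subst fa.Fubini'[symmetric]) auto
qed

lemma nn_integral_collision_right:
  assumes "finite_borel_measure f" "finite_borel_measure g"
    and [measurable]: "\<phi> \<in> borel_measurable borel"
  shows "(\<integral>\<^sup>+z. \<phi> z \<partial>collision f g) =
    (\<integral>\<^sup>+x. \<integral>\<^sup>+\<theta>. \<integral>\<^sup>+y. \<phi> (x * cos \<theta> + y * sin \<theta>) \<partial>g \<partial>angle \<partial>f)"
proof -
  interpret f: finite_borel_measure f by fact
  interpret g: finite_borel_measure g by fact
  note [measurable_cong] = f.M_is_borel g.M_is_borel
  interpret ga: pair_sigma_finite g angle by unfold_locales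
  show ?thesis
    unfolding nn_integral_collision[OF assms]
    by (intro nn_integral_cong, subst ga.Fubini') auto
qed

lemma real_distributionI_nn_integral:
  assumes "sets M = sets borel" "(\<integral>\<^sup>+x. 1 \<partial>M) = 1"
  shows "real_distribution M"
  using assms by (auto simp: real_distribution_def real_distribution_axioms_def intro!: prob_spaceI)

lemma real_distribution_collision:
  assumes "real_distribution f" "real_distribution g"
  shows "real_distribution (collision f g)"
proof (rule real_distributionI_nn_integral)
  interpret f: real_distribution f by fact
  interpret g: real_distribution g by fact
  show "sets (collision f g) = sets borel"
    using finite_borel_measure_collision[OF f.finite_borel_measure_M g.finite_borel_measure_M]
    by (simp add: finite_borel_measure.M_is_borel)
  show "(\<integral>\<^sup>+x. 1 \<partial>collision f g) = 1"
    using f.emeasure_space_1 g.emeasure_space_1 angle.emeasure_space_1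
    by (subst nn_integral_collision[OF f.finite_borel_measure_M g.finite_borel_measure_M]) auto
qed

section \<open>Stability of the collision measure under setwise perturbations\<close>

lemma nn_integral_indicator_vimage:
  assumes "sets h = sets borel" "T \<in> borel_measurable borel" "A \<in> sets borel"
  shows "(\<integral>\<^sup>+x. indicator A (T x :: real) \<partial>h) = emeasure h (T -` A)"
  using assms measurable_sets[OF assms(2,3)]
  by (subst nn_integral_indicator[symmetric]) (simp_all add: indicator_vimage cong: nn_integral_cong)

text \<open>For fixed \<open>y\<close> and \<open>\<theta>\<close> the inner integral is the mass of
  an affine preimage of \<open>A\<close>, where the hypothesis costs \<open>e\<close>; averaging
  over the angle keeps \<open>e\<close> and integrating over \<open>g\<close> multiplies it by the
  mass of \<open>g\<close>. The one-sided additive form avoids subtraction in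
  \<open>ennreal\<close>.\<close>

lemma collision_mono_left:
  assumes f: "finite_borel_measure f" and f': "finite_borel_measure f'"
    and g: "finite_borel_measure g"
    and le: "\<And>A. A \<in> sets borel \<Longrightarrow> emeasure f A \<le> emeasure f' A + e"
    and A[measurable]: "A \<in> sets borel"
  shows "emeasure (collision f g) A \<le> emeasure (collision f' g) A + e * emeasure g UNIV"
proof -
  interpret f: finite_borel_measure f by fact
  interpret f': finite_borel_measure f' by fact
  interpret g: finite_borel_measure g by fact
  note [measurable_cong] = f.M_is_borel f'.M_is_borel g.M_is_borel
  have sp: "space f = UNIV" "space f' = UNIV" "space g = UNIV"
    using f.M_is_borel f'.M_is_borel g.M_is_borel by (auto dest: sets_eq_imp_space_eq)
  have *: "emeasure (collision h g) A = (\<integral>\<^sup>+y. \<integral>\<^sup>+\<theta>. \<integral>\<^sup>+x. indicator A (x * cos \<theta> + y * sin \<theta>) \<partial>h \<partial>angle \<partial>g)"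
    if "finite_borel_measure h" for h
    using finite_borel_measure.M_is_borel[OF finite_borel_measure_collision[OF that g]]
    by (subst nn_integral_collision_left[OF that g, symmetric]) auto
  have "(\<integral>\<^sup>+x. indicator A (x * c + d) \<partial>f) \<le> (\<integral>\<^sup>+x. indicator A (x * c + d) \<partial>f') + e" for c d
    using le[of "(\<lambda>x. x * c + d) -` A"] measurable_sets[of "\<lambda>x. x * c + d" borel borel A]
    by (simp add: nn_integral_indicator_vimage f.M_is_borel f'.M_is_borel A)
  then have "emeasure (collision f g) A \<le>
    (\<integral>\<^sup>+y. \<integral>\<^sup>+\<theta>. (\<integral>\<^sup>+x. indicator A (x * cos \<theta> + y * sin \<theta>) \<partial>f') + e \<partial>angle \<partial>g)"
    unfolding *[OF f] by (intro nn_integral_mono)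
  also have "\<dots> = (\<integral>\<^sup>+y. (\<integral>\<^sup>+\<theta>. (\<integral>\<^sup>+x. indicator A (x * cos \<theta> + y * sin \<theta>) \<partial>f') \<partial>angle) + e \<partial>g)"
    using angle.emeasure_space_1 by (intro nn_integral_cong) (subst nn_integral_add; simp)
  also have "\<dots> = emeasure (collision f' g) A + e * emeasure g UNIV"
    unfolding *[OF f'] by (subst nn_integral_add) (auto simp: sp)
  finally show ?thesis .
qed

lemma collision_mono_right:
  assumes f: "finite_borel_measure f" and f': "finite_borel_measure f'"
    and g: "finite_borel_measure g"
    and le: "\<And>A. A \<in> sets borel \<Longrightarrow> emeasure f A \<le> emeasure f' A + e"
    and A[measurable]: "A \<in> sets borel"
  shows "emeasure (collision g f) A \<le> emeasure (collision g f') A + e * emeasure g UNIV"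
proof -
  interpret f: finite_borel_measure f by fact
  interpret f': finite_borel_measure f' by fact
  interpret g: finite_borel_measure g by fact
  note [measurable_cong] = f.M_is_borel f'.M_is_borel g.M_is_borel
  have sp: "space f = UNIV" "space f' = UNIV" "space g = UNIV"
    using f.M_is_borel f'.M_is_borel g.M_is_borel by (auto dest: sets_eq_imp_space_eq)
  have *: "emeasure (collision g h) A = (\<integral>\<^sup>+x. \<integral>\<^sup>+\<theta>. \<integral>\<^sup>+y. indicator A (x * cos \<theta> + y * sin \<theta>) \<partial>h \<partial>angle \<partial>g)"
    if "finite_borel_measure h" for h
    using finite_borel_measure.M_is_borel[OF finite_borel_measure_collision[OF g that]]
    by (subst nn_integral_collision_right[OF g that, symmetric]) auto
  have "(\<integral>\<^sup>+x. indicator A (d + x * c) \<partial>f) \<le> (\<integral>\<^sup>+x. indicator A (d + x * c) \<partial>f') + e" for c d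
    using le[of "(\<lambda>x. d + x * c) -` A"] measurable_sets[of "\<lambda>x. d + x * c" borel borel A]
    by (simp add: nn_integral_indicator_vimage f.M_is_borel f'.M_is_borel A)
  then have "emeasure (collision g f) A \<le>
    (\<integral>\<^sup>+x. \<integral>\<^sup>+\<theta>. (\<integral>\<^sup>+y. indicator A (x * cos \<theta> + y * sin \<theta>) \<partial>f') + e \<partial>angle \<partial>g)"
    unfolding *[OF f] by (intro nn_integral_mono)
  also have "\<dots> = (\<integral>\<^sup>+x. (\<integral>\<^sup>+\<theta>. (\<integral>\<^sup>+y. indicator A (x * cos \<theta> + y * sin \<theta>) \<partial>f') \<partial>angle) + e \<partial>g)"
    using angle.emeasure_space_1 by (intro nn_integral_cong) (subst nn_integral_add; simp)
  also have "\<dots> = emeasure (collision g f') A + e * emeasure g UNIV"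
    unfolding *[OF f'] by (subst nn_integral_add) (auto simp: sp)
  finally show ?thesis .
qed

section \<open>Mixtures and Wild sums\<close>

lemma nn_integral_nat_pmf:
  fixes P :: "nat pmf"
  shows "(\<integral>\<^sup>+i. h i \<partial>measure_pmf P) = (\<Sum>i. ennreal (pmf P i) * h i)"
  by (simp add: nn_integral_measure_pmf nn_integral_count_space_nat)

text \<open>Measurability in the index is automatic because every set is measurable for a
  \<open>pmf\<close>; only the values have to be checked.\<close>

lemma mixture_in_subprob_algebra:
  assumes "\<And>i. real_distribution (N i)"
  shows "N \<in> measure_pmf P \<rightarrow>\<^sub>M subprob_algebra borel"
  using assms
  by (auto simp: space_subprob_algebra real_distribution_def real_distribution_axioms_def
      prob_space_imp_subprob_space)

lemma nn_integral_mixture: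
  assumes "\<And>i. real_distribution (N i)" "\<phi> \<in> borel_measurable borel"
  shows "(\<integral>\<^sup>+x. \<phi> x \<partial>(measure_pmf P \<bind> N)) = (\<integral>\<^sup>+i. \<integral>\<^sup>+x. \<phi> x \<partial>N i \<partial>measure_pmf P)"
  by (rule nn_integral_bind[OF assms(2) mixture_in_subprob_algebra[OF assms(1)]])

lemma emeasure_mixture:
  assumes "\<And>i. real_distribution (N i)" "A \<in> sets borel"
  shows "emeasure (measure_pmf P \<bind> N) A = (\<integral>\<^sup>+i. emeasure (N i) A \<partial>measure_pmf P)"
  by (rule emeasure_bind[OF _ mixture_in_subprob_algebra[OF assms(1)] assms(2)]) auto

lemma real_distribution_mixture:
  assumes "\<And>i. real_distribution (N i)"
  shows "real_distribution (measure_pmf P \<bind> N)"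
proof (rule real_distributionI_nn_integral)
  show "sets (measure_pmf P \<bind> N) = sets borel"
    using assms by (intro sets_bind) (auto simp: real_distribution.events_eq_borel)
  show "(\<integral>\<^sup>+x. 1 \<partial>(measure_pmf P \<bind> N)) = 1"
    using assms by (subst nn_integral_mixture) (auto simp: real_distribution.axioms(1) prob_space.emeasure_space_1)
qed

lemma nn_integral_collision_mixture_left:
  assumes N: "\<And>i. real_distribution (N i)" and g: "real_distribution g"
    and [measurable]: "\<phi> \<in> borel_measurable borel"
  shows "(\<integral>\<^sup>+z. \<phi> z \<partial>collision (measure_pmf P \<bind> N) g) =
    (\<integral>\<^sup>+i. \<integral>\<^sup>+z. \<phi> z \<partial>collision (N i) g \<partial>measure_pmf P)"
proof -
  interpret g: real_distribution g by fact
  note fin = real_distribution.finite_borel_measure_M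
  show ?thesis
    using N g real_distribution_mixture[of N, OF N]
    by (simp add: nn_integral_collision fin nn_integral_mixture)
qed

text \<open>Here the mixture sits under the outer integral, so the two must be exchanged. Weights on
  the natural numbers turn the mixture into a series, and monotone convergence does the
  exchange.\<close>

lemma nn_integral_collision_mixture_right:
  fixes P :: "nat pmf"
  assumes N: "\<And>i. real_distribution (N i)" and g: "real_distribution g"
    and [measurable]: "\<phi> \<in> borel_measurable borel"
  shows "(\<integral>\<^sup>+z. \<phi> z \<partial>collision g (measure_pmf P \<bind> N)) =
    (\<integral>\<^sup>+i. \<integral>\<^sup>+z. \<phi> z \<partial>collision g (N i) \<partial>measure_pmf P)"
proof -
  interpret g: real_distribution g by fact
  interpret N: real_distribution "N i" for i by fact
  note fin = real_distribution.finite_borel_measure_M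
  show ?thesis
    using N g real_distribution_mixture[of N, OF N]
    by (simp add: nn_integral_collision fin nn_integral_mixture nn_integral_nat_pmf
        nn_integral_suminf nn_integral_cmult)
qed

text \<open>Row \<open>i\<close> is shifted right by \<open>i\<close> places and padded with zeros,
  so that antidiagonals become columns; exchanging the two nonnegative sums then gives the
  claim.\<close>

lemma ennreal_suminf_antidiagonal:
  fixes a :: "nat \<Rightarrow> nat \<Rightarrow> ennreal"
  shows "(\<Sum>i. \<Sum>j. a i j) = (\<Sum>n. \<Sum>k\<le>n. a k (n - k))"
proof -
  define b where "b i n = (if i \<le> n then a i (n - i) else 0)" for i n
  have b: "(\<Sum>i. b i n) = (\<Sum>k\<le>n. a k (n - k))" for n
    by (subst suminf_finite[of "{..n}"]) (auto simp: b_def)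
  have "(\<Sum>j. a i j) = (\<Sum>n. b i n)" for i
    using suminf_offset[OF summableI, of "b i" i] by (simp add: b_def[abs_def])
  then have "(\<Sum>i. \<Sum>j. a i j) = (\<Sum>i. \<integral>\<^sup>+n. b i n \<partial>count_space UNIV)"
    by (simp add: nn_integral_count_space_nat)
  also have "\<dots> = (\<integral>\<^sup>+n. (\<Sum>i. b i n) \<partial>count_space UNIV)"
    by (subst nn_integral_suminf) auto
  also have "\<dots> = (\<Sum>n. \<Sum>i. b i n)"
    by (simp add: nn_integral_count_space_nat)
  also have "\<dots> = (\<Sum>n. \<Sum>k\<le>n. a k (n - k))"
    by (simp add: b)
  finally show ?thesis .
qed

lemma real_distribution_gaussian:
  assumes "T > 0"
  shows "real_distribution (gaussian T)"
  unfolding real_distribution_def real_distribution_axioms_def gaussian_def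
  using prob_space_normal_density[of "sqrt T"] assms by auto

section \<open>The averaged collision and Wild's recursion\<close>

locale thermostated_kac =
  fixes lam mu T :: real and f\<^sub>0 :: "real measure"
  assumes lam: "lam > 0" and mu: "mu > 0" and T: "T > 0"
    and f0: "real_distribution f\<^sub>0"
begin

abbreviation rate :: real where "rate \<equiv> 2 * lam + mu"

text \<open>This is \<open>D[f, g]\<close> of the overview. A biased coin decides between a
  collision partner from \<open>g\<close> and one from the thermostat; in this form the general
  facts on mixtures apply.\<close>

definition mean_collision :: "real measure \<Rightarrow> real measure \<Rightarrow> real measure" where
  "mean_collision f g = measure_pmf (bernoulli_pmf (2 * lam / rate)) \<bind>
     (\<lambda>b. collision f (if b then g else gaussian T))"

lemma real_distribution_mean_collision:
  assumes "real_distribution f" "real_distribution g"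
  shows "real_distribution (mean_collision f g)"
  unfolding mean_collision_def
  by (intro real_distribution_mixture real_distribution_collision)
     (auto simp: assms real_distribution_gaussian T)

lemma nn_integral_mean_collision:
  assumes "real_distribution f" "real_distribution g" "\<phi> \<in> borel_measurable borel"
  shows "(\<integral>\<^sup>+x. \<phi> x \<partial>mean_collision f g) =
    ennreal (2 * lam / rate) * (\<integral>\<^sup>+x. \<phi> x \<partial>collision f g) +
    ennreal (mu / rate) * (\<integral>\<^sup>+x. \<phi> x \<partial>collision f (gaussian T))"
proof -
  have "1 - 2 * lam / rate = mu / rate"
    using lam mu by (simp add: field_simps)
  moreover have "real_distribution (collision f (if b then g else gaussian T))" for b
    using assms by (simp add: real_distribution_collision real_distribution_gaussian T)
  ultimately show ?thesis
    unfolding mean_collision_def using lam mu assms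
    by (subst nn_integral_mixture) (auto simp: ac_simps)
qed

text \<open>The thermostat term is linear in the first argument only, yet it fits into the double
  sum: it is constant in \<open>j\<close>, and the weights of \<open>P\<close> add up to one. This
  is what absorbs it into a bilinear operation.\<close>

lemma nn_integral_mean_collision_mixture:
  fixes P :: "nat pmf"
  assumes N: "\<And>i. real_distribution (N i)" and \<phi>: "\<phi> \<in> borel_measurable borel"
  shows "(\<integral>\<^sup>+x. \<phi> x \<partial>mean_collision (measure_pmf P \<bind> N) (measure_pmf P \<bind> N)) =
    (\<integral>\<^sup>+i. \<integral>\<^sup>+j. \<integral>\<^sup>+x. \<phi> x \<partial>mean_collision (N i) (N j) \<partial>measure_pmf P \<partial>measure_pmf P)"
proof -
  note rd = N real_distribution_mixture[of N, OF N] real_distribution_gaussian[OF T]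
  have "(\<integral>\<^sup>+x. \<phi> x \<partial>collision (measure_pmf P \<bind> N) (measure_pmf P \<bind> N)) =
     (\<integral>\<^sup>+i. \<integral>\<^sup>+j. \<integral>\<^sup>+x. \<phi> x \<partial>collision (N i) (N j) \<partial>measure_pmf P \<partial>measure_pmf P)"
    by (subst nn_integral_collision_mixture_left)
       (simp_all add: rd \<phi> nn_integral_collision_mixture_right)
  moreover have "(\<integral>\<^sup>+x. \<phi> x \<partial>collision (measure_pmf P \<bind> N) (gaussian T)) =
     (\<integral>\<^sup>+i. \<integral>\<^sup>+x. \<phi> x \<partial>collision (N i) (gaussian T) \<partial>measure_pmf P)"
    by (rule nn_integral_collision_mixture_left) (simp_all add: rd \<phi>)
  ultimately show ?thesis
    by (simp add: nn_integral_mean_collision rd \<phi> nn_integral_add nn_integral_cmult)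
qed

text \<open>In \<open>wild (Suc n)\<close> the index \<open>k\<close> only ranges over \<open>{..n}\<close>; the minimum makes termination evident.\<close>

fun wild :: "nat \<Rightarrow> real measure" where
  "wild 0 = f\<^sub>0"
| "wild (Suc n) = measure_pmf (pmf_of_set {..n}) \<bind>
     (\<lambda>k. mean_collision (wild (min k n)) (wild (n - k)))"

lemma real_distribution_wild: "real_distribution (wild n)"
proof (induction n rule: less_induct)
  case (less n)
  show ?case
  proof (cases n)
    case (Suc m)
    then show ?thesis
      using less by (auto intro!: real_distribution_mixture real_distribution_mean_collision)
  qed (simp add: f0)
qed

lemma nn_integral_wild_Suc:
  assumes "\<phi> \<in> borel_measurable borel"
  shows "(\<integral>\<^sup>+x. \<phi> x \<partial>wild (Suc n)) =
    (\<Sum>k\<le>n. \<integral>\<^sup>+x. \<phi> x \<partial>mean_collision (wild k) (wild (n - k))) / ennreal (real (Suc n))"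
  by (simp add: nn_integral_mixture[OF _ assms] real_distribution_mean_collision
      real_distribution_wild nn_integral_pmf_of_set
      ennreal_of_nat_eq_real_of_nat del: of_nat_Suc)

text \<open>The parameter is the success probability \<open>p = exp (- rate * t)\<close> instead of
  the time \<open>t\<close>; time zero is \<open>p = 1\<close>, where all weight lies on
  \<open>wild 0\<close>.\<close>

definition wild_sum :: "real \<Rightarrow> real measure" where
  "wild_sum p = measure_pmf (geometric_pmf p) \<bind> wild"

lemma real_distribution_wild_sum: "real_distribution (wild_sum p)"
  unfolding wild_sum_def by (rule real_distribution_mixture[OF real_distribution_wild])

text \<open>The product of two geometric weights depends only on \<open>n = i + j\<close>. Grouping
  by \<open>n\<close> leaves the sum over \<open>k \<le> n\<close> of the recursion for
  \<open>wild\<close>, that is, \<open>n + 1\<close> times the average defining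
  \<open>wild (Suc n)\<close>. The factor \<open>n + 1\<close> is what makes a derivative appear
  later.\<close>

lemma emeasure_mean_collision_wild_sum:
  assumes p: "0 < p" "p \<le> 1" and A: "A \<in> sets borel"
  shows "emeasure (mean_collision (wild_sum p) (wild_sum p)) A =
    (\<Sum>n. ennreal (p\<^sup>2 * (1 - p) ^ n * real (Suc n)) * emeasure (wild (Suc n)) A)"
proof -
  let ?d = "\<lambda>i j. emeasure (mean_collision (wild i) (wild j)) A"
  have em: "emeasure M A = (\<integral>\<^sup>+x. indicator A x \<partial>M)" if "real_distribution M" for M
    using A that by (simp add: real_distribution.events_eq_borel)
  note rd = real_distribution_wild real_distribution_mean_collision
  have ac: "ennreal ((1 - p) ^ i * p) * (ennreal ((1 - p) ^ j * p) * x) =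
      ennreal (p\<^sup>2 * (1 - p) ^ (i + j)) * x" for i j x
  proof -
    have "p\<^sup>2 * (1 - p) ^ (i + j) = ((1 - p) ^ i * p) * ((1 - p) ^ j * p)"
      by (simp add: power_add power2_eq_square)
    then show ?thesis
      using p by (simp only: ennreal_mult[symmetric] mult.assoc[symmetric]) (simp add: ennreal_mult ac_simps)
  qed
  have "emeasure (mean_collision (wild_sum p) (wild_sum p)) A =
     (\<integral>\<^sup>+i. \<integral>\<^sup>+j. ?d i j \<partial>geometric_pmf p \<partial>geometric_pmf p)"
    unfolding em[OF real_distribution_mean_collision[OF real_distribution_wild_sum real_distribution_wild_sum]]
    unfolding wild_sum_def using A
    by (subst nn_integral_mean_collision_mixture) (auto simp: em rd)
  also have "\<dots> = (\<Sum>i. \<Sum>j. ennreal (p\<^sup>2 * (1 - p) ^ (i + j)) * ?d i j)"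
    using p
    by (simp add: nn_integral_nat_pmf pmf_geometric ac ennreal_suminf_cmult[symmetric]
        del: ennreal_suminf_cmult)
  also have "\<dots> = (\<Sum>n. \<Sum>k\<le>n. ennreal (p\<^sup>2 * (1 - p) ^ n) * ?d k (n - k))"
    by (subst ennreal_suminf_antidiagonal) simp
  also have "\<dots> = (\<Sum>n. ennreal (p\<^sup>2 * (1 - p) ^ n * real (Suc n)) * emeasure (wild (Suc n)) A)"
  proof (rule suminf_cong)
    fix n
    have cancel: "ennreal (real (Suc n)) * (x / ennreal (real (Suc n))) = x" for x
      by (subst ennreal_times_divide, subst mult.commute, subst ennreal_mult_divide_eq)
         (simp_all del: of_nat_Suc)
    have "(\<Sum>k\<le>n. ?d k (n - k)) = ennreal (real (Suc n)) * emeasure (wild (Suc n)) A"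
      unfolding em[OF real_distribution_wild] using A
      by (subst nn_integral_wild_Suc)
         (auto simp: em rd cancel simp del: of_nat_Suc)
    then show "(\<Sum>k\<le>n. ennreal (p\<^sup>2 * (1 - p) ^ n) * ?d k (n - k)) =
        ennreal (p\<^sup>2 * (1 - p) ^ n * real (Suc n)) * emeasure (wild (Suc n)) A"
      using p by (simp add: sum_distrib_left[symmetric] ennreal_mult mult.assoc del: of_nat_Suc)
  qed
  finally show ?thesis .
qed

end

section \<open>The mild equation\<close>

lemma partition_sum_abs_le:
  assumes \<mu>: "finite_borel_measure \<mu>" and \<nu>: "finite_borel_measure \<nu>"
    and le: "\<And>A. A \<in> sets borel \<Longrightarrow> \<bar>measure \<mu> A - measure \<nu> A\<bar> \<le> e"
    and P: "finite P" "P \<subseteq> sets borel" "partition_on UNIV P"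
  shows "(\<Sum>A\<in>P. \<bar>measure \<mu> A - measure \<nu> A\<bar>) \<le> 2 * e"
proof -
  interpret \<mu>: finite_borel_measure \<mu> by fact
  interpret \<nu>: finite_borel_measure \<nu> by fact
  have *: "\<bar>\<Sum>A\<in>Q. measure \<mu> A - measure \<nu> A\<bar> \<le> e" if Q: "Q \<subseteq> P" for Q
  proof -
    have "disjoint_family_on id Q"
      using partition_onD2[OF P(3)] Q by (auto simp: disjoint_family_on_def disjoint_def)
    moreover have "finite Q"
      using Q P(1) finite_subset by blast
    moreover have "Q \<subseteq> sets borel"
      using Q P(2) by blast
    ultimately have "(\<Sum>A\<in>Q. measure \<mu> A - measure \<nu> A) = measure \<mu> (\<Union>Q) - measure \<nu> (\<Union>Q)"
      using \<mu>.finite_measure_finite_Union[of Q id] \<nu>.finite_measure_finite_Union[of Q id]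
      by (simp add: sum_subtractf \<mu>.M_is_borel \<nu>.M_is_borel)
    moreover have "\<Union>Q \<in> sets borel"
      using Q P finite_subset by (intro sets.finite_Union) auto
    ultimately show ?thesis
      using le by simp
  qed
  let ?d = "\<lambda>A. measure \<mu> A - measure \<nu> A"
  \<comment> \<open>A finite Hahn decomposition: the cells of each sign are merged into one Borel
    set, and each of the two sets contributes at most \<open>e\<close>.\<close>
  have "(\<Sum>A\<in>P. \<bar>?d A\<bar>) = (\<Sum>A\<in>{A\<in>P. 0 \<le> ?d A}. \<bar>?d A\<bar>) + (\<Sum>A\<in>{A\<in>P. \<not> 0 \<le> ?d A}. \<bar>?d A\<bar>)"
    using P(1) by (subst sum.union_disjoint[symmetric]) (auto intro!: sum.cong)
  also have "\<dots> = (\<Sum>A\<in>{A\<in>P. 0 \<le> ?d A}. ?d A) - (\<Sum>A\<in>{A\<in>P. \<not> 0 \<le> ?d A}. ?d A)"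
    unfolding sum_negf[symmetric] diff_conv_add_uminus by (intro arg_cong2[where f="(+)"] sum.cong) auto
  also have "\<dots> \<le> 2 * e"
    using *[of "{A\<in>P. 0 \<le> ?d A}"] *[of "{A\<in>P. \<not> 0 \<le> ?d A}"] by auto
  finally show ?thesis .
qed

lemma tv_dist_le:
  assumes "finite_borel_measure \<mu>" "finite_borel_measure \<nu>"
    and "\<And>A. A \<in> sets borel \<Longrightarrow> \<bar>measure \<mu> A - measure \<nu> A\<bar> \<le> e"
  shows "tv_dist \<mu> \<nu> \<le> 2 * e"
  unfolding tv_dist_def
proof (rule cSUP_least)
  have "{UNIV} \<in> {P. finite P \<and> P \<subseteq> sets borel \<and> partition_on (UNIV :: real set) P}"
    by (auto simp: partition_on_def)
  then show "{P. finite P \<and> P \<subseteq> sets borel \<and> partition_on (UNIV :: real set) P} \<noteq> {}"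
    by blast
qed (use partition_sum_abs_le[OF assms] in auto)

lemma abs_measure_diff_le_tv_dist:
  assumes \<mu>: "finite_borel_measure \<mu>" and \<nu>: "finite_borel_measure \<nu>"
    and A: "A \<in> sets borel"
  shows "\<bar>measure \<mu> A - measure \<nu> A\<bar> \<le> tv_dist \<mu> \<nu>"
proof -
  interpret \<mu>: finite_borel_measure \<mu> by fact
  interpret \<nu>: finite_borel_measure \<nu> by fact
  let ?S = "{P. finite P \<and> P \<subseteq> sets borel \<and> partition_on (UNIV :: real set) P}"
  let ?s = "\<lambda>P. \<Sum>A\<in>P. \<bar>measure \<mu> A - measure \<nu> A\<bar>"
  \<comment> \<open>The real supremum in \<open>tv_dist\<close> is an upper bound only once the sums
    are known to be bounded; the total masses provide this.\<close>
  have "\<bar>measure \<mu> B - measure \<nu> B\<bar> \<le> measure \<mu> (space \<mu>) + measure \<nu> (space \<nu>)" for B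
    using \<mu>.bounded_measure[of B] \<nu>.bounded_measure[of B]
      measure_nonneg[of \<mu> B] measure_nonneg[of \<nu> B] by linarith
  note b = partition_sum_abs_le[OF \<mu> \<nu> this]
  have bdd: "bdd_above (?s ` ?S)"
    by (rule bdd_aboveI2[of _ _ "2 * (measure \<mu> (space \<mu>) + measure \<nu> (space \<nu>))"]) (use b in auto)
  \<comment> \<open>The partition that detects \<open>A\<close>; an empty cell is removed because
    \<open>partition_on\<close> forbids it.\<close>
  have "{A, - A} - {{}} \<in> ?S"
    using A by (auto simp: partition_on_def disjoint_def)
  then have "?s ({A, - A} - {{}}) \<le> tv_dist \<mu> \<nu>"
    unfolding tv_dist_def by (rule cSUP_upper[OF _ bdd])
  moreover have "\<bar>measure \<mu> A - measure \<nu> A\<bar> \<le> ?s ({A, - A} - {{}})"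
  proof (cases "A = {}")
    case False
    then show ?thesis
      by (intro member_le_sum[of A]) auto
  qed (auto intro: sum_nonneg)
  ultimately show ?thesis by simp
qed

lemma summable_bounded_power_series:
  fixes q :: "nat \<Rightarrow> real" and z :: real
  assumes "\<And>n. \<bar>q n\<bar> \<le> 1" "\<bar>z\<bar> < 1"
  shows "summable (\<lambda>n. q n * z ^ n)"
proof (rule summable_comparison_test')
  show "summable (\<lambda>n. \<bar>z\<bar> ^ n)"
    using assms by (intro summable_geometric) auto
  show "norm (q n * z ^ n) \<le> \<bar>z\<bar> ^ n" if "0 \<le> n" for n
    using mult_right_mono[OF assms(1)[of n], of "\<bar>z\<bar> ^ n"] by (simp add: abs_mult power_abs)
qed

section \<open>Existence: the Wild sum as a power series on each Borel set\<close>

context thermostated_kac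
begin

lemma finite_borel_wild_sum: "finite_borel_measure (wild_sum p)"
  by (rule real_distribution.finite_borel_measure_M[OF real_distribution_wild_sum])

lemma emeasure_eq_measure_wild: "emeasure (wild n) A = ennreal (measure (wild n) A)"
  using real_distribution_wild[of n]
  by (intro finite_measure.emeasure_eq_measure) (simp add: real_distribution_def prob_space_def)

lemma measure_wild_sum_sums:
  assumes "0 < p" "p \<le> 1" "A \<in> sets borel"
  shows "(\<lambda>n. p * (measure (wild n) A * (1 - p) ^ n)) sums measure (wild_sum p) A"
proof -
  interpret real_distribution "wild_sum p" by (rule real_distribution_wild_sum)
  have "(\<Sum>n. ennreal (p * (measure (wild n) A * (1 - p) ^ n))) = ennreal (measure (wild_sum p) A)"
    unfolding emeasure_eq_measure[symmetric] unfolding wild_sum_def using assms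
    by (subst emeasure_mixture)
       (auto simp: real_distribution_wild nn_integral_nat_pmf pmf_geometric emeasure_eq_measure_wild
         ennreal_mult ac_simps)
  then have "(\<lambda>n. ennreal (p * (measure (wild n) A * (1 - p) ^ n))) sums ennreal (measure (wild_sum p) A)"
    by (simp add: sums_iff)
  then show ?thesis
    using assms by (subst (asm) sums_ennreal) auto
qed

lemma measure_mean_collision:
  assumes "real_distribution f" "real_distribution g" "A \<in> sets borel"
  shows "rate * measure (mean_collision f g) A =
    2 * lam * measure (collision f g) A + mu * measure (collision f (gaussian T)) A"
proof -
  have em: "(\<integral>\<^sup>+x. indicator A x \<partial>M) = ennreal (measure M A)" if "real_distribution M" for M
  proof -
    interpret real_distribution M by fact
    show ?thesis using assms(3) by (simp add: emeasure_eq_measure)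
  qed
  have rd: "real_distribution (collision f g)" "real_distribution (collision f (gaussian T))"
    "real_distribution (mean_collision f g)"
    using assms by (simp_all add: real_distribution_collision real_distribution_mean_collision
        real_distribution_gaussian T)
  have nonneg: "0 \<le> 2 * lam / rate" "0 \<le> mu / rate"
    using lam mu by simp_all
  have lin: "ennreal (a * x + b * y) = ennreal a * ennreal x + ennreal b * ennreal y"
    if "0 \<le> a" "0 \<le> b" "0 \<le> x" "0 \<le> y" for a b x y
    using that by (simp add: ennreal_mult ennreal_plus)
  have "ennreal (measure (mean_collision f g) A) =
     ennreal (2 * lam / rate * measure (collision f g) A + mu / rate * measure (collision f (gaussian T)) A)"
    using nn_integral_mean_collision[OF assms(1,2), of "indicator A"] assms(3)
    by (simp only: em rd lin nonneg measure_nonneg borel_measurable_indicator)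
  then have "measure (mean_collision f g) A =
     2 * lam / rate * measure (collision f g) A + mu / rate * measure (collision f (gaussian T)) A"
    using lam mu by (subst (asm) ennreal_inj) auto
  then show ?thesis
    using lam mu by (simp add: distrib_left)
qed

text \<open>The coefficients \<open>diffs\<close> are those of the termwise derivative, so the
  averaged collision is \<open>p\<^sup>2\<close> times the derivative, at \<open>1 - p\<close>, of
  the power series that represents \<open>wild_sum p\<close> up to its factor
  \<open>p\<close>.\<close>

lemma measure_mean_collision_wild_sum_sums:
  assumes "0 < p" "p \<le> 1" "A \<in> sets borel"
  shows "(\<lambda>n. p\<^sup>2 * (diffs (\<lambda>n. measure (wild n) A) n * (1 - p) ^ n)) sums
    measure (mean_collision (wild_sum p) (wild_sum p)) A"
proof -
  interpret real_distribution "mean_collision (wild_sum p) (wild_sum p)"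
    by (intro real_distribution_mean_collision real_distribution_wild_sum)
  have "(\<Sum>n. ennreal (p\<^sup>2 * (diffs (\<lambda>n. measure (wild n) A) n * (1 - p) ^ n))) =
      ennreal (measure (mean_collision (wild_sum p) (wild_sum p)) A)"
    unfolding emeasure_eq_measure[symmetric] emeasure_mean_collision_wild_sum[OF assms]
    using assms by (simp add: emeasure_eq_measure_wild ennreal_mult[symmetric] diffs_def ac_simps
        del: of_nat_Suc wild.simps)
  then have "(\<lambda>n. ennreal (p\<^sup>2 * (diffs (\<lambda>n. measure (wild n) A) n * (1 - p) ^ n))) sums
      ennreal (measure (mean_collision (wild_sum p) (wild_sum p)) A)"
    by (simp add: sums_iff)
  then show ?thesis
    using assms by (subst (asm) sums_ennreal) (auto simp: diffs_def)
qed

text \<open>The value \<open>undefined\<close> at negative times matches the extensional curves, so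
  that uniqueness can be an equality of functions.\<close>

definition solution :: "real \<Rightarrow> real measure" where
  "solution t = (if 0 \<le> t then wild_sum (exp (- rate * t)) else undefined)"

lemma rate_pos: "rate > 0"
  using lam mu by simp

lemma exp_rate_le_1:
  assumes "0 \<le> s"
  shows "exp (- rate * s) \<le> 1"
  using mult_nonneg_nonneg[OF less_imp_le[OF rate_pos] assms]
  by (simp only: exp_le_one_iff mult_minus_left neg_le_0_iff_le)

text \<open>With \<open>F\<close> the power series with coefficients
  \<open>measure (wild n) A\<close>, the left side is \<open>p * F (1 - p)\<close> for
  \<open>p = exp (- rate * t)\<close>. The integrand is \<open>exp (- rate * t)\<close> times the
  derivative of \<open>F (1 - exp (- rate * s))\<close> in \<open>s\<close>, so the integral
  telescopes to the values at \<open>t\<close> and at zero.\<close>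

lemma measure_solution_mild:
  assumes t: "0 \<le> t" and A: "A \<in> sets borel"
  shows "measure (wild_sum (exp (- rate * t))) A = exp (- rate * t) * measure f\<^sub>0 A +
    (LINT s:{0..t}|lborel. exp (- rate * (t - s)) * (rate *
       measure (mean_collision (wild_sum (exp (- rate * s))) (wild_sum (exp (- rate * s)))) A))"
proof -
  define q where "q n = measure (wild n) A" for n
  define F where "F z = (\<Sum>n. q n * z ^ n)" for z :: real
  define F' where "F' z = (\<Sum>n. diffs q n * z ^ n)" for z :: real
  define G' where "G' s = F' (1 - exp (- rate * s)) * (rate * exp (- rate * s))" for s
  have q: "\<bar>q n\<bar> \<le> 1" for n
  proof -
    interpret real_distribution "wild n" by (rule real_distribution_wild)
    show ?thesis by (simp add: q_def)
  qed
  have sq: "summable (\<lambda>n. q n * z ^ n)" if "norm z < 1" for z :: real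
    using summable_bounded_power_series[of q z] q that by simp
  have sdq: "summable (\<lambda>n. diffs q n * z ^ n)" if "norm z < 1" for z :: real
    by (rule termdiff_converges[OF that sq])
  have F: "(F has_field_derivative F' z) (at z)" if "norm z < 1" for z
    unfolding F_def F'_def by (rule termdiffs_strong'[OF sq that])
  have "isCont F' z" if "norm z < 1" for z
    unfolding F'_def by (rule DERIV_isCont[OF termdiffs_strong'[OF sdq that]])
  then have cF': "continuous_on {-1<..<1} F'"
    by (auto simp: continuous_on_eq_continuous_at)
  have p: "0 < exp (- rate * s)" "exp (- rate * s) \<le> 1" if "0 \<le> s" for s
    using exp_rate_le_1[OF that] by auto
  \<comment> \<open>At finite times the argument stays strictly inside the disc of
    convergence.\<close>
  have range: "1 - exp (- rate * s) \<in> {-1<..<1}" if "s \<in> {0..t}" for s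
  proof -
    have "0 \<le> s" using that by simp
    from p[OF this] show ?thesis
      by (simp only: greaterThanLessThan_iff) linarith
  qed
  have dG: "((\<lambda>s. F (1 - exp (- rate * s))) has_vector_derivative G' s) (at s within {0..t})"
    if "0 \<le> s" for s
  proof -
    have "((\<lambda>s. F (1 - exp (- rate * s))) has_field_derivative G' s) (at s)"
      unfolding G'_def
      by (rule DERIV_chain2[OF F])
         (use p[OF that] in \<open>auto intro!: derivative_eq_intros simp: algebra_simps\<close>)
    then show ?thesis
      by (simp add: has_real_derivative_iff_has_vector_derivative has_vector_derivative_at_within)
  qed
  have cG': "continuous_on {0..t} G'"
    unfolding G'_def
    by (intro continuous_intros continuous_on_compose2[OF cF'] image_subsetI range) auto
  have "(LINT s:{0..t}|lborel. exp (- rate * (t - s)) * (rate *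
       measure (mean_collision (wild_sum (exp (- rate * s))) (wild_sum (exp (- rate * s)))) A)) =
     (LINT s:{0..t}|lborel. exp (- rate * t) * G' s)"
  proof (rule set_lebesgue_integral_cong)
    show "\<forall>s. s \<in> {0..t} \<longrightarrow> exp (- rate * (t - s)) * (rate *
       measure (mean_collision (wild_sum (exp (- rate * s))) (wild_sum (exp (- rate * s)))) A) =
       exp (- rate * t) * G' s"
    proof safe
      fix s assume s: "s \<in> {0..t}"
      let ?p = "exp (- rate * s)"
      have "norm (1 - ?p) < 1"
        using p[of s] s by auto
      from sums_unique2[OF measure_mean_collision_wild_sum_sums[OF p A]
          sums_mult[OF summable_sums[OF sdq[OF this]], unfolded q_def]] s
      have "measure (mean_collision (wild_sum ?p) (wild_sum ?p)) A = ?p\<^sup>2 * F' (1 - ?p)"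
        by (simp add: F'_def q_def[abs_def])
      \<comment> \<open>One factor \<open>?p\<close> turns the damping into a constant in
        \<open>s\<close>; the other is the inner derivative demanded by the chain rule.\<close>
      moreover have "exp (- rate * (t - s)) * ?p\<^sup>2 = exp (- rate * t) * ?p"
        by (simp add: power2_eq_square exp_add[symmetric] algebra_simps)
      ultimately show "exp (- rate * (t - s)) * (rate *
         measure (mean_collision (wild_sum ?p) (wild_sum ?p)) A) = exp (- rate * t) * G' s"
        by (simp add: G'_def)
    qed
  qed simp
  also have "\<dots> = exp (- rate * t) * (F (1 - exp (- rate * t)) - F (1 - exp (- rate * 0)))"
    unfolding set_integral_mult_right set_lebesgue_integral_def
    by (subst integral_FTC_Icc[OF t dG cG']) auto
  also have "F (1 - exp (- rate * 0)) = measure f\<^sub>0 A"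
    by (simp add: F_def q_def)
  also have "exp (- rate * t) * (F (1 - exp (- rate * t)) - measure f\<^sub>0 A) =
      measure (wild_sum (exp (- rate * t))) A - exp (- rate * t) * measure f\<^sub>0 A"
  proof -
    have "norm (1 - exp (- rate * t)) < 1"
      using p[OF t] by auto
    from sums_unique2[OF measure_wild_sum_sums[OF p A]
        sums_mult[OF summable_sums[OF sq[OF this]], unfolded q_def]] t
    show ?thesis
      by (simp add: F_def q_def right_diff_distrib)
  qed
  finally show ?thesis
    by simp
qed

lemma mild_solution_solution: "mild_solution lam mu T f\<^sub>0 solution"
  unfolding mild_solution_def
proof (intro allI impI ballI)
  fix t :: real and A :: "real set"
  assume t: "0 \<le> t" and A: "A \<in> sets borel"
  have "(LINT s:{0..t}|lborel. exp (- rate * (t - s)) * (rate *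
       measure (mean_collision (wild_sum (exp (- rate * s))) (wild_sum (exp (- rate * s)))) A)) =
    (LINT s:{0..t}|lborel. exp (- rate * (t - s)) *
       (2 * lam * measure (collision (solution s) (solution s)) A +
        mu * measure (collision (solution s) (gaussian T)) A))"
    by (rule set_lebesgue_integral_cong)
       (auto simp: solution_def measure_mean_collision[OF real_distribution_wild_sum real_distribution_wild_sum A])
  then show "measure (solution t) A = exp (- rate * t) * measure f\<^sub>0 A +
     (LINT s:{0..t}|lborel. exp (- rate * (t - s)) *
       (2 * lam * measure (collision (solution s) (solution s)) A +
        mu * measure (collision (solution s) (gaussian T)) A))"
    using measure_solution_mild[OF t A] t by (simp add: solution_def)
qed

text \<open>After division by the parameter both sides are power series with the same coefficients
  in [0, 1], at the ordered points \<open>1 - p \<le> 1 - p'\<close>. Termwise, their difference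
  lies between zero and the corresponding difference of geometric series. The bound does not depend
  on \<open>A\<close>, hence controls total variation.\<close>

lemma measure_wild_sum_diff_le:
  assumes p': "0 < p'" "p' \<le> p" and p: "p \<le> 1" and A: "A \<in> sets borel"
  shows "\<bar>measure (wild_sum p') A - measure (wild_sum p) A\<bar> \<le> (p - p') / p"
proof -
  let ?m = "\<lambda>p. measure (wild_sum p) A"
  interpret w: real_distribution "wild n" for n by (rule real_distribution_wild)
  interpret real_distribution "wild_sum p" by (rule real_distribution_wild_sum)
  have s: "(\<lambda>n. measure (wild n) A * (1 - p) ^ n) sums (?m p / p)" if "0 < p" "p \<le> 1" for p
    using sums_mult[OF measure_wild_sum_sums[OF that A], of "1/p"] that by simp
  have g: "(\<lambda>n. (1 - p) ^ n) sums (1 / p)" if "0 < p" "p \<le> 1" for p :: real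
    using geometric_sums[of "1 - p"] that by simp
  have D: "(\<lambda>n. measure (wild n) A * ((1 - p') ^ n - (1 - p) ^ n)) sums (?m p' / p' - ?m p / p)"
    using sums_diff[OF s[of p'] s[of p]] assms by (simp add: right_diff_distrib)
  have E: "(\<lambda>n. (1 - p') ^ n - (1 - p) ^ n) sums (1 / p' - 1 / p)"
    using sums_diff[OF g[of p'] g[of p]] assms by simp
  have pos: "0 \<le> (1 - p') ^ n - (1 - p) ^ n" for n
    using power_mono[of "1 - p" "1 - p'" n] assms by simp
  have lo: "0 \<le> ?m p' / p' - ?m p / p"
    by (rule sums_le[OF _ sums_zero D]) (use pos in simp)
  have hi: "?m p' / p' - ?m p / p \<le> 1 / p' - 1 / p"
    by (rule sums_le[OF _ D E]) (use pos in \<open>simp add: mult_left_le_one_le\<close>)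
  have eq: "p' * (?m p' / p' - ?m p / p) = ?m p' - ?m p * (p' / p)"
    "p' * (1 / p' - 1 / p) = 1 - p' / p"
    using assms by (simp_all add: right_diff_distrib)
  have lo': "?m p * (p' / p) \<le> ?m p'"
    using mult_left_mono[OF lo, of p'] p'(1) unfolding eq by simp
  have hi': "?m p' \<le> ?m p * (p' / p) + (1 - p' / p)"
    using mult_left_mono[OF hi, of p'] p'(1) unfolding eq by simp
  have r: "0 \<le> 1 - p' / p"
    using assms by simp
  have "?m p * (1 - p' / p) \<le> 1 - p' / p" "0 \<le> ?m p * (1 - p' / p)"
    using r by (simp_all add: mult_left_le_one_le)
  with lo' hi' have "\<bar>?m p' - ?m p\<bar> \<le> 1 - p' / p"
    unfolding right_diff_distrib by linarith
  then show ?thesis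
    using assms by (simp add: diff_divide_distrib)
qed

lemma solution_in_tv_continuous_curves: "solution \<in> tv_continuous_curves"
proof -
  have cont: "((\<lambda>s. tv_dist (solution s) (solution t)) \<longlongrightarrow> 0) (at t within {0..})" if t: "0 \<le> t" for t
  proof (rule Lim_null_comparison)
    let ?p = "\<lambda>s. exp (- rate * s)"
    have p: "0 < ?p s" "?p s \<le> 1" if "0 \<le> s" for s
      using exp_rate_le_1[OF that] by auto
    have "norm (tv_dist (solution s) (solution t)) \<le> 2 * (\<bar>?p s - ?p t\<bar> / ?p t)" if s: "0 \<le> s" for s
    proof -
      have "\<bar>measure (solution s) A - measure (solution t) A\<bar> \<le> \<bar>?p s - ?p t\<bar> / ?p t"
        if A: "A \<in> sets borel" for A
      \<comment> \<open>The estimate divides by the larger parameter; when that is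
        \<open>?p s\<close>, it is replaced by the smaller, fixed \<open>?p t\<close>.\<close>
      proof (cases "?p s \<le> ?p t")
        case True
        then show ?thesis
          using measure_wild_sum_diff_le[OF p(1)[OF s] True p(2)[OF t] A] s t
          by (simp add: solution_def)
      next
        case False
        then have le: "?p t \<le> ?p s" by simp
        have "(?p s - ?p t) / ?p s \<le> (?p s - ?p t) / ?p t"
          using le p[OF t] p[OF s] by (intro divide_left_mono) auto
        then show ?thesis
          using measure_wild_sum_diff_le[OF p(1)[OF t] le p(2)[OF s] A] s t le
          by (simp add: solution_def abs_minus_commute)
      qed
      \<comment> \<open>The instance at the empty set says that \<open>tv_dist\<close> is
        nonnegative, which removes the norm.\<close>
      from tv_dist_le[OF _ _ this] abs_measure_diff_le_tv_dist[of "solution s" "solution t" "{}"]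
      show ?thesis
        using s t by (simp add: solution_def finite_borel_wild_sum)
    qed
    then show "\<forall>\<^sub>F s in at t within {0..}. norm (tv_dist (solution s) (solution t)) \<le> 2 * (\<bar>?p s - ?p t\<bar> / ?p t)"
      by (auto simp: eventually_at_filter)
    have "((\<lambda>s. 2 * (\<bar>?p s - ?p t\<bar> / ?p t)) \<longlongrightarrow> 2 * (\<bar>?p t - ?p t\<bar> / ?p t)) (at t within {0..})"
      by (intro tendsto_intros) auto
    then show "((\<lambda>s. 2 * (\<bar>?p s - ?p t\<bar> / ?p t)) \<longlongrightarrow> 0) (at t within {0..})"
      by simp
  qed
  then show ?thesis
    by (auto simp: tv_continuous_curves_def PiE_def extensional_def solution_def finite_borel_wild_sum)
qed

end

section \<open>Uniqueness\<close>

lemma measure_collision_le_left: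
  assumes f: "finite_borel_measure f" and g: "finite_borel_measure g" and h: "finite_borel_measure h"
    and le: "\<And>A. A \<in> sets borel \<Longrightarrow> measure f A \<le> measure g A + e" and e: "0 \<le> e"
    and A: "A \<in> sets borel"
  shows "measure (collision f h) A \<le> measure (collision g h) A + e * measure h UNIV"
proof -
  have em: "emeasure k B = ennreal (measure k B)" if "finite_borel_measure k" for k B
    using that by (simp add: finite_borel_measure_def finite_measure.emeasure_eq_measure)
  have "emeasure (collision f h) A \<le> emeasure (collision g h) A + ennreal e * emeasure h UNIV"
    by (rule collision_mono_left[OF f g h _ A])
       (use le e in \<open>simp add: em f g ennreal_plus[symmetric] del: ennreal_plus\<close>)
  then show ?thesis
    using e by (simp add: em f g h finite_borel_measure_collision ennreal_mult[symmetric]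
        ennreal_plus[symmetric] del: ennreal_plus)
qed

lemma measure_collision_le_right:
  assumes f: "finite_borel_measure f" and g: "finite_borel_measure g" and h: "finite_borel_measure h"
    and le: "\<And>A. A \<in> sets borel \<Longrightarrow> measure f A \<le> measure g A + e" and e: "0 \<le> e"
    and A: "A \<in> sets borel"
  shows "measure (collision h f) A \<le> measure (collision h g) A + e * measure h UNIV"
proof -
  have em: "emeasure k B = ennreal (measure k B)" if "finite_borel_measure k" for k B
    using that by (simp add: finite_borel_measure_def finite_measure.emeasure_eq_measure)
  have "emeasure (collision h f) A \<le> emeasure (collision h g) A + ennreal e * emeasure h UNIV"
    by (rule collision_mono_right[OF f g h _ A])
       (use le e in \<open>simp add: em f g ennreal_plus[symmetric] del: ennreal_plus\<close>)
  then show ?thesis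
    using e by (simp add: em f g h finite_borel_measure_collision ennreal_mult[symmetric]
        ennreal_plus[symmetric] del: ennreal_plus)
qed

context thermostated_kac
begin

text \<open>For uniqueness the competing curves are merely finite measures, so the original
  unnormalized terms are used in place of \<open>mean_collision\<close>, whose properties are
  established for probability measures.\<close>

definition gain :: "real measure \<Rightarrow> real set \<Rightarrow> real" where
  "gain f A = 2 * lam * measure (collision f f) A + mu * measure (collision f (gaussian T)) A"

text \<open>Replacing \<open>f\<close> by \<open>g\<close> in one slot of the quadratic term at a
  time costs \<open>e * M\<close> twice; the thermostat term costs \<open>e\<close>, since the
  Gaussian has mass one. Weighting by \<open>2 * lam\<close> and \<open>mu\<close> gives the
  constant.\<close>

lemma gain_le:
  assumes f: "finite_borel_measure f" and g: "finite_borel_measure g"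
    and le: "\<And>A. A \<in> sets borel \<Longrightarrow> measure f A \<le> measure g A + e" and e: "0 \<le> e"
    and M: "measure f UNIV \<le> M" "measure g UNIV \<le> M" and A: "A \<in> sets borel"
  shows "gain f A \<le> gain g A + (4 * lam * M + mu) * e"
proof -
  interpret G: real_distribution "gaussian T" by (rule real_distribution_gaussian[OF T])
  have "measure (collision f f) A \<le> measure (collision g f) A + e * M"
    using measure_collision_le_left[OF f g f le e A] mult_left_mono[OF M(1) e] by linarith
  moreover have "measure (collision g f) A \<le> measure (collision g g) A + e * M"
    using measure_collision_le_right[OF f g g le e A] mult_left_mono[OF M(2) e] by linarith
  ultimately have "2 * lam * measure (collision f f) A \<le> 2 * lam * (measure (collision g g) A + 2 * (e * M))"
    using lam by (intro mult_left_mono) auto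
  moreover have "mu * measure (collision f (gaussian T)) A \<le>
      mu * (measure (collision g (gaussian T)) A + e)"
    using measure_collision_le_left[OF f g G.finite_borel_measure_M le e A] G.prob_space mu
    by (intro mult_left_mono) auto
  ultimately show ?thesis
    by (simp add: gain_def algebra_simps)
qed

lemma gain_diff_le:
  assumes f: "finite_borel_measure f" and g: "finite_borel_measure g"
    and le: "\<And>A. A \<in> sets borel \<Longrightarrow> \<bar>measure f A - measure g A\<bar> \<le> e"
    and M: "measure f UNIV \<le> M" "measure g UNIV \<le> M" and A: "A \<in> sets borel"
  shows "\<bar>gain f A - gain g A\<bar> \<le> (4 * lam * M + mu) * e"
proof -
  have e: "0 \<le> e"
    using le[of "{}"] by simp
  have "measure f B \<le> measure g B + e" "measure g B \<le> measure f B + e" if "B \<in> sets borel" for B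
    using le[OF that] by auto
  then show ?thesis
    using gain_le[OF f g _ e M A] gain_le[OF g f _ e M(2,1) A] by (auto simp: abs_le_iff)
qed

lemma tv_continuous_curveD:
  assumes "f \<in> tv_continuous_curves" "0 \<le> t"
  shows "finite_borel_measure (f t)"
    and "((\<lambda>s. tv_dist (f s) (f t)) \<longlongrightarrow> 0) (at t within {0..})"
  using assms by (auto simp: tv_continuous_curves_def PiE_def Pi_def)

lemma continuous_on_measure_curve:
  assumes f: "f \<in> tv_continuous_curves" and A: "A \<in> sets borel"
  shows "continuous_on {0..} (\<lambda>s. measure (f s) A)"
  unfolding continuous_on_def
proof
  fix t :: real assume t: "t \<in> {0..}"
  have "((\<lambda>s. measure (f s) A - measure (f t) A) \<longlongrightarrow> 0) (at t within {0..})"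
  proof (rule Lim_null_comparison)
    show "\<forall>\<^sub>F s in at t within {0..}. norm (measure (f s) A - measure (f t) A) \<le> tv_dist (f s) (f t)"
      unfolding eventually_at_filter
      using abs_measure_diff_le_tv_dist[OF tv_continuous_curveD(1)[OF f] tv_continuous_curveD(1)[OF f] A] t
      by auto
  qed (use tv_continuous_curveD(2)[OF f] t in auto)
  then show "((\<lambda>s. measure (f s) A) \<longlongrightarrow> measure (f t) A) (at t within {0..})"
    by (rule LIM_zero_cancel)
qed

text \<open>The Lipschitz bound is applied with \<open>e\<close> the total variation distance and a
  mass bound that itself depends on this distance. Continuity provides the integrability needed to
  subtract two mild equations.\<close>

lemma continuous_on_gain_curve:
  assumes f: "f \<in> tv_continuous_curves" and A: "A \<in> sets borel"
  shows "continuous_on {0..} (\<lambda>s. gain (f s) A)"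
  unfolding continuous_on_def
proof
  fix t :: real assume t: "t \<in> {0..}"
  let ?d = "\<lambda>s. tv_dist (f s) (f t)" and ?m = "measure (f t) UNIV"
  have "((\<lambda>s. gain (f s) A - gain (f t) A) \<longlongrightarrow> 0) (at t within {0..})"
  proof (rule Lim_null_comparison)
    have "norm (gain (f s) A - gain (f t) A) \<le> (4 * lam * (?m + ?d s) + mu) * ?d s" if s: "0 \<le> s" for s
    proof -
      have fin: "finite_borel_measure (f s)" "finite_borel_measure (f t)"
        using tv_continuous_curveD(1)[OF f] s t by auto
      note d = abs_measure_diff_le_tv_dist[OF fin]
      show ?thesis
        using gain_diff_le[OF fin d _ _ A, of "?m + ?d s"] d[of UNIV] by auto
    qed
    then show "\<forall>\<^sub>F s in at t within {0..}. norm (gain (f s) A - gain (f t) A) \<le>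
        (4 * lam * (?m + ?d s) + mu) * ?d s"
      by (auto simp: eventually_at_filter)
    have "((\<lambda>s. (4 * lam * (?m + ?d s) + mu) * ?d s) \<longlongrightarrow> (4 * lam * (?m + 0) + mu) * 0) (at t within {0..})"
      using tv_continuous_curveD(2)[OF f] t by (intro tendsto_intros) auto
    then show "((\<lambda>s. (4 * lam * (?m + ?d s) + mu) * ?d s) \<longlongrightarrow> 0) (at t within {0..})"
      by simp
  qed
  then show "((\<lambda>s. gain (f s) A) \<longlongrightarrow> gain (f t) A) (at t within {0..})"
    by (rule LIM_zero_cancel)
qed

lemma mild_solution_unique_on:
  assumes f: "f \<in> tv_continuous_curves" "mild_solution lam mu T f\<^sub>0 f"
    and g: "g \<in> tv_continuous_curves" "mild_solution lam mu T f\<^sub>0 g"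
    and A: "A \<in> sets borel" and t0: "0 \<le> t0"
  shows "measure (f t0) A = measure (g t0) A"
proof -
  have fin: "finite_borel_measure (f s)" "finite_borel_measure (g s)" if "0 \<le> s" for s
    using tv_continuous_curveD(1) f(1) g(1) that by auto
  \<comment> \<open>Masses of unknown solutions are controlled by compactness of the time interval;
    this gives the Lipschitz constant \<open>L\<close> below.\<close>
  have "continuous_on {0..t0} (\<lambda>s. measure (f s) UNIV + measure (g s) UNIV)"
    by (intro continuous_intros continuous_on_subset[OF continuous_on_measure_curve[OF f(1)]]
        continuous_on_subset[OF continuous_on_measure_curve[OF g(1)]]) auto
  from compact_imp_bounded[OF compact_continuous_image[OF this compact_Icc]]
  obtain M where M: "\<And>s. s \<in> {0..t0} \<Longrightarrow> \<bar>measure (f s) UNIV + measure (g s) UNIV\<bar> \<le> M"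
    unfolding bounded_iff by (metis imageI real_norm_def)
  have Mfg: "measure (f s) UNIV \<le> M" "measure (g s) UNIV \<le> M" if "s \<in> {0..t0}" for s
    using M[OF that] measure_nonneg[of "f s" UNIV] measure_nonneg[of "g s" UNIV] by linarith+
  have M0: "0 \<le> M"
    using order_trans[OF measure_nonneg Mfg(1)[of 0]] t0 by simp
  define L where "L = 4 * lam * M + mu"
  have L0: "0 \<le> L"
    using M0 lam mu by (simp add: L_def)
  \<comment> \<open>The induction must range over all times and all Borel sets at once, because the
    gain on one set involves the measures on every Borel set.\<close>
  have bound: "\<bar>measure (f t) A - measure (g t) A\<bar> \<le> M * (L * t) ^ n / fact n"
    if "t \<in> {0..t0}" "A \<in> sets borel" for n t A
    using that
  proof (induction n arbitrary: t A)
    case 0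
    have m: "measure k A \<le> measure k UNIV" if "finite_borel_measure k" for k
    proof -
      interpret finite_borel_measure k by fact
      show ?thesis by (intro finite_measure_mono) (auto simp: M_is_borel)
    qed
    have "0 \<le> t" using 0 by simp
    then have "\<bar>measure (f t) A - measure (g t) A\<bar> \<le> M"
      using m[OF fin(1), of t] m[OF fin(2), of t] Mfg[OF 0(1)]
        measure_nonneg[of "f t" A] measure_nonneg[of "g t" A]
      by linarith
    then show ?case by simp
  next
    case (Suc n)
    let ?e = "\<lambda>s. exp (- rate * (t - s))"
    have t: "0 \<le> t" "t \<le> t0" using Suc.prems by auto
    have int: "set_integrable lborel {0..t} (\<lambda>s. ?e s * gain (h s) A)"
      if "h \<in> tv_continuous_curves" for h
      by (intro borel_integrable_atLeastAtMost' continuous_intros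
          continuous_on_subset[OF continuous_on_gain_curve[OF that Suc.prems(2)]]) auto
    have intb: "set_integrable lborel {0..t} (\<lambda>s. L * (M * (L * s) ^ n / fact n))"
      by (intro borel_integrable_atLeastAtMost' continuous_intros) auto
    have diff: "measure (f t) A - measure (g t) A =
        (LINT s:{0..t}|lborel. ?e s * gain (f s) A - ?e s * gain (g s) A)"
      using f(2) g(2) t Suc.prems(2) int[OF f(1)] int[OF g(1)]
      by (simp add: mild_solution_def set_integral_diff gain_def)
    have "\<bar>measure (f t) A - measure (g t) A\<bar> \<le>
        (LINT s:{0..t}|lborel. norm (?e s * gain (f s) A - ?e s * gain (g s) A))"
      unfolding diff real_norm_def[symmetric]
      by (rule set_integral_norm_bound[OF set_integral_diff(1)[OF int[OF f(1)] int[OF g(1)]]])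
    also have "\<dots> \<le> (LINT s:{0..t}|lborel. L * (M * (L * s) ^ n / fact n))"
    proof (rule set_integral_mono)
      show "set_integrable lborel {0..t} (\<lambda>s. norm (?e s * gain (f s) A - ?e s * gain (g s) A))"
        by (rule set_integrable_norm[OF set_integral_diff(1)[OF int[OF f(1)] int[OF g(1)]]])
      show "norm (?e s * gain (f s) A - ?e s * gain (g s) A) \<le> L * (M * (L * s) ^ n / fact n)"
        if s: "s \<in> {0..t}" for s
      proof -
        have s': "s \<in> {0..t0}" "0 \<le> s" using s t by auto
        \<comment> \<open>The exponential damping is simply discarded.\<close>
        have "?e s \<le> 1"
          using exp_rate_le_1[of "t - s"] s by simp
        then have "?e s * \<bar>gain (f s) A - gain (g s) A\<bar> \<le> \<bar>gain (f s) A - gain (g s) A\<bar>"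
          by (intro mult_left_le_one_le) auto
        also have "\<dots> \<le> L * (M * (L * s) ^ n / fact n)"
          unfolding L_def
          by (rule gain_diff_le[OF fin[OF s'(2)] Suc.IH[OF s'(1), unfolded L_def] Mfg[OF s'(1)] Suc.prems(2)])
        finally show ?thesis
          by (simp add: right_diff_distrib[symmetric] abs_mult)
      qed
    qed (rule intb)
    also have "\<dots> = (L * M * L ^ n / fact n) * (\<integral>s. s ^ n * indicator {0..t} s \<partial>lborel)"
      unfolding set_lebesgue_integral_def integral_mult_right_zero[symmetric]
      by (intro Bochner_Integration.integral_cong) (auto simp: power_mult_distrib)
    also have "\<dots> = M * (L * t) ^ Suc n / fact (Suc n)"
      using t by (subst integral_power) (auto simp: power_mult_distrib divide_simps)
    finally show ?case .
  qed
  \<comment> \<open>Terms of the convergent exponential series tend to zero.\<close>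
  have "(\<lambda>n. M * (inverse (fact n) * (L * t0) ^ n)) \<longlonglongrightarrow> M * 0"
    by (intro tendsto_intros summable_LIMSEQ_zero summable_exp)
  then have "(\<lambda>n. M * (L * t0) ^ n / fact n) \<longlonglongrightarrow> 0"
    by (simp add: divide_inverse ac_simps)
  then have "\<bar>measure (f t0) A - measure (g t0) A\<bar> \<le> 0"
    by (rule tendsto_lowerbound) (use bound[OF _ A, of t0] t0 in auto)
  then show ?thesis by simp
qed

lemma mild_solution_eq_solution:
  assumes f: "f \<in> tv_continuous_curves" "mild_solution lam mu T f\<^sub>0 f"
  shows "f = solution"
proof
  fix t
  show "f t = solution t"
  proof (cases "0 \<le> t")
    case True
    interpret finite_borel_measure "f t"
      by (rule tv_continuous_curveD(1)[OF f(1) True])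
    interpret s: finite_borel_measure "solution t"
      by (rule tv_continuous_curveD(1)[OF solution_in_tv_continuous_curves True])
    show ?thesis
      using mild_solution_unique_on[OF f solution_in_tv_continuous_curves mild_solution_solution _ True]
      by (intro measure_eqI) (auto simp: M_is_borel s.M_is_borel emeasure_eq_measure s.emeasure_eq_measure)
  next
    case False
    then show ?thesis
      using f(1) by (auto simp: tv_continuous_curves_def solution_def PiE_def extensional_def)
  qed
qed

end

section \<open>Densities and moments\<close>

text \<open>For almost every angle, freezing \<open>y\<close> leaves an invertible affine map of
  \<open>x\<close>, which pulls Lebesgue null sets back to Lebesgue null sets and hence to null sets
  of \<open>f\<close>. The first argument alone supplies the regularity.\<close>

lemma absolutely_continuous_collision:
  assumes f: "finite_borel_measure f" and g: "finite_borel_measure g"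
    and ac: "absolutely_continuous lborel f"
  shows "absolutely_continuous lborel (collision f g)"
  unfolding absolutely_continuous_def
proof
  fix N :: "real set" assume N: "N \<in> null_sets lborel"
  then have [measurable]: "N \<in> sets borel" by auto
  note sets = finite_borel_measure.M_is_borel[OF f]
    finite_borel_measure.M_is_borel[OF finite_borel_measure_collision[OF f g]]
  have "(\<integral>\<^sup>+x. indicator N (x * c + d) \<partial>f) = 0" if "c \<noteq> 0" for c d :: real
  proof -
    have "AE x in lborel. d + c * x \<notin> N"
      by (rule AE_borel_affine[OF that]) (use AE_not_in[OF N] in auto)
    then have "AE x in f. d + c * x \<notin> N"
      by (rule absolutely_continuous_AE[OF _ ac, rotated]) (simp add: sets)
    then show ?thesis
      by (subst nn_integral_0_iff_AE)
         (auto simp: measurable_cong_sets[OF sets(1) refl] indicator_def ac_simps elim!: eventually_mono)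
  qed
  then have "(\<integral>\<^sup>+\<theta>. \<integral>\<^sup>+x. indicator N (x * cos \<theta> + y * sin \<theta>) \<partial>f \<partial>angle) = (\<integral>\<^sup>+\<theta>. 0 \<partial>angle)" for y
    by (intro nn_integral_cong_AE eventually_mono[OF AE_angle_cos]) auto
  then have "emeasure (collision f g) N = 0"
    using nn_integral_collision_left[OF f g, of "indicator N"] by (simp add: sets)
  then show "N \<in> null_sets (collision f g)"
    by (auto simp: null_sets_def sets)
qed

text \<open>Radon-Nikodym reduces densities to null sets, which pass through mixtures without
  constructing any density.\<close>

lemma has_lebesgue_density_iff:
  assumes "sets f = sets borel"
  shows "has_lebesgue_density f \<longleftrightarrow> absolutely_continuous lborel f"
proof
  assume "has_lebesgue_density f"
  then show "absolutely_continuous lborel f"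
    by (auto simp: has_lebesgue_density_def intro: absolutely_continuousI_density)
next
  assume "absolutely_continuous lborel f"
  from sigma_finite_measure.Radon_Nikodym[OF sigma_finite_lborel this] assms
  show "has_lebesgue_density f"
    by (auto simp: has_lebesgue_density_def)
qed

lemma absolutely_continuous_mixture:
  assumes "\<And>i. real_distribution (N i)" "\<And>i. absolutely_continuous M (N i)" "sets M = sets borel"
  shows "absolutely_continuous M (measure_pmf P \<bind> N)"
  unfolding absolutely_continuous_def
proof
  fix A assume A: "A \<in> null_sets M"
  then have "A \<in> sets borel" using assms(3) by auto
  moreover have "emeasure (N i) A = 0" for i
    using assms(2)[of i] A by (auto simp: absolutely_continuous_def)
  ultimately show "A \<in> null_sets (measure_pmf P \<bind> N)"
    using assms(1) real_distribution.events_eq_borel[OF real_distribution_mixture[of N P, OF assms(1)]]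
    by (auto simp: null_sets_def emeasure_mixture)
qed

section \<open>Absolute moments, taken in \<open>ennreal\<close> so that Tonelli needs no
  integrability\<close>

definition abs_moment :: "real \<Rightarrow> real measure \<Rightarrow> ennreal" where
  "abs_moment r f = (\<integral>\<^sup>+v. ennreal (\<bar>v\<bar> powr r) \<partial>f)"

lemma finite_moment_iff:
  assumes "sets f = sets borel"
  shows "finite_moment r f \<longleftrightarrow> abs_moment r f < \<infinity>"
  unfolding finite_moment_def abs_moment_def integrable_iff_bounded
  by (simp add: measurable_cong_sets[OF assms refl])

text \<open>The combination is at most twice the larger of the two absolute values. The crude
  constant \<open>2 powr r\<close> is harmless, as it only affects the degree of the later
  polynomial growth.\<close>

lemma powr_abs_collision_le:
  fixes x y \<theta> r :: real
  assumes "0 \<le> r"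
  shows "\<bar>x * cos \<theta> + y * sin \<theta>\<bar> powr r \<le> 2 powr r * (\<bar>x\<bar> powr r + \<bar>y\<bar> powr r)"
proof -
  have "\<bar>x * cos \<theta>\<bar> \<le> \<bar>x\<bar>" "\<bar>y * sin \<theta>\<bar> \<le> \<bar>y\<bar>"
    by (simp_all add: abs_mult mult_left_le)
  then have "\<bar>x * cos \<theta> + y * sin \<theta>\<bar> \<le> 2 * max \<bar>x\<bar> \<bar>y\<bar>"
    by linarith
  then have "\<bar>x * cos \<theta> + y * sin \<theta>\<bar> powr r \<le> (2 * max \<bar>x\<bar> \<bar>y\<bar>) powr r"
    using assms by (intro powr_mono2) auto
  also have "\<dots> = 2 powr r * max \<bar>x\<bar> \<bar>y\<bar> powr r"
    by (simp add: powr_mult)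
  also have "\<dots> \<le> 2 powr r * (\<bar>x\<bar> powr r + \<bar>y\<bar> powr r)"
    by (intro mult_left_mono) (auto simp: max_def)
  finally show ?thesis .
qed

lemma abs_moment_collision_le:
  assumes r: "0 \<le> r" and f: "real_distribution f" and g: "real_distribution g"
  shows "abs_moment r (collision f g) \<le> ennreal (2 powr r) * (abs_moment r f + abs_moment r g)"
proof -
  interpret f: real_distribution f by fact
  interpret g: real_distribution g by fact
  note fin = f.finite_borel_measure_M g.finite_borel_measure_M
  have "abs_moment r (collision f g) =
      (\<integral>\<^sup>+x. \<integral>\<^sup>+y. \<integral>\<^sup>+\<theta>. ennreal (\<bar>x * cos \<theta> + y * sin \<theta>\<bar> powr r) \<partial>angle \<partial>g \<partial>f)"
    unfolding abs_moment_def by (rule nn_integral_collision[OF fin]) measurable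
  also have "\<dots> \<le> (\<integral>\<^sup>+x. \<integral>\<^sup>+y. \<integral>\<^sup>+\<theta>.
      ennreal (2 powr r) * (ennreal (\<bar>x\<bar> powr r) + ennreal (\<bar>y\<bar> powr r)) \<partial>angle \<partial>g \<partial>f)"
    using powr_abs_collision_le[OF r]
    by (intro nn_integral_mono) (simp add: ennreal_plus[symmetric] ennreal_mult[symmetric] del: ennreal_plus)
  also have "\<dots> = ennreal (2 powr r) * (abs_moment r f + abs_moment r g)"
    using f.emeasure_space_1 g.emeasure_space_1 angle.emeasure_space_1
    by (simp add: abs_moment_def nn_integral_cmult nn_integral_add)
  finally show ?thesis .
qed

text \<open>The real power is dominated by \<open>\<bar>x\<bar> ^ k + 1\<close> for an integer
  \<open>k \<ge> r\<close>, reducing to integer moments of the normal law.\<close>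

lemma abs_moment_gaussian_finite:
  assumes "0 \<le> r" "0 < T"
  shows "abs_moment r (gaussian T) < \<infinity>"
proof -
  define k where "k = nat \<lceil>r\<rceil>"
  have k: "r \<le> real k" by (simp add: k_def real_nat_ceiling_ge)
  have *: "integrable lborel (\<lambda>x. normal_density 0 (sqrt T) x * \<bar>x\<bar> ^ k)"
    "integrable lborel (normal_density 0 (sqrt T))"
    using integrable_normal_moment_abs[of "sqrt T" 0 k] assms by auto
  have "integrable lborel (\<lambda>x. normal_density 0 (sqrt T) x * \<bar>x\<bar> powr r)"
  proof (rule Bochner_Integration.integrable_bound[OF Bochner_Integration.integrable_add[OF *]])
    have "\<bar>x\<bar> powr r \<le> \<bar>x\<bar> ^ k + 1" for x :: real
    proof (cases "\<bar>x\<bar> \<le> 1")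
      case True
      then have "\<bar>x\<bar> powr r \<le> 1 powr r"
        using assms by (intro powr_mono2) auto
      then show ?thesis by (simp add: add_increasing)
    next
      case False
      then have "\<bar>x\<bar> powr r \<le> \<bar>x\<bar> powr real k"
        using k by (intro powr_mono) auto
      then show ?thesis using False by (simp add: powr_realpow)
    qed
    from mult_left_mono[OF this, of "normal_density 0 (sqrt T) x" for x]
    show "AE x in lborel. norm (normal_density 0 (sqrt T) x * \<bar>x\<bar> powr r) \<le>
        norm (normal_density 0 (sqrt T) x * \<bar>x\<bar> ^ k + normal_density 0 (sqrt T) x)"
      by (auto simp: abs_mult distrib_left)
  qed simp
  then have "integrable (gaussian T) (\<lambda>x. \<bar>x\<bar> powr r)"
    unfolding gaussian_def by (subst integrable_density) auto
  then show ?thesis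
    using finite_moment_iff[of "gaussian T" r] by (simp add: finite_moment_def gaussian_def)
qed

text \<open>Both sides equal \<open>Suc (n + K) * (n + K choose K)\<close>. The identity serves both
  the differentiation of binomial series and the hockey-stick computation.\<close>

lemma Suc_times_choose_shift:
  "Suc n * (Suc n + K choose K) = Suc K * (Suc (n + K) choose Suc K)"
proof -
  have "Suc n * (Suc n + K choose K) = Suc (n + K) * (n + K choose K)"
    using binomial_absorb_comp[of "Suc n + K" K] by simp
  also have "\<dots> = Suc K * (Suc (n + K) choose Suc K)"
    by (metis Suc_times_binomial_eq mult.commute)
  finally show ?thesis .
qed

text \<open>Induction on \<open>K\<close> from the geometric series: termwise differentiation raises
  \<open>K\<close> by one, up to the factor \<open>Suc K\<close>.\<close>

lemma summable_choose_power:
  fixes z :: real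
  assumes "norm z < 1"
  shows "summable (\<lambda>n. real (n + K choose K) * z ^ n)"
  using assms
proof (induction K arbitrary: z)
  case 0
  then show ?case by (simp add: summable_geometric)
next
  case (Suc K)
  have "diffs (\<lambda>n. real (n + K choose K)) n = real (Suc K) * real (n + Suc K choose Suc K)" for n
    unfolding diffs_def of_nat_mult[symmetric] Suc_times_choose_shift by simp
  with termdiff_converges[OF Suc.prems Suc.IH]
  have "summable (\<lambda>n. real (Suc K) * (real (n + Suc K choose Suc K) * z ^ n))"
    by (simp only: mult.assoc)
  from summable_mult_D[OF this] show ?case
    by simp
qed

section \<open>Propagation of densities and moments to the Wild sum\<close>

context thermostated_kac
begin

lemma absolutely_continuous_wild:
  assumes "absolutely_continuous lborel f\<^sub>0"
  shows "absolutely_continuous lborel (wild n)"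
proof (induction n rule: less_induct)
  case (less n)
  show ?case
  proof (cases n)
    case (Suc m)
    have rd: "real_distribution (if b then wild i else gaussian T)" for b i
      by (simp add: real_distribution_wild real_distribution_gaussian T)
    \<comment> \<open>In both branches the first argument is an earlier term of the recursion, so
      the induction hypothesis applies to it.\<close>
    have "absolutely_continuous lborel (collision (wild (min k m)) (if b then wild i else gaussian T))"
      for k b i
      using less[of "min k m"] Suc real_distribution.finite_borel_measure_M[OF rd]
        real_distribution.finite_borel_measure_M[OF real_distribution_wild]
      by (intro absolutely_continuous_collision) auto
    then have "absolutely_continuous lborel (mean_collision (wild (min k m)) (wild i))" for k i
      unfolding mean_collision_def
      by (intro absolutely_continuous_mixture real_distribution_collision real_distribution_wild rd) auto
    then show ?thesis
      unfolding Suc wild.simps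
      by (intro absolutely_continuous_mixture real_distribution_mean_collision real_distribution_wild) auto
  qed (simp add: assms)
qed

lemma has_lebesgue_density_wild_sum:
  assumes "has_lebesgue_density f\<^sub>0"
  shows "has_lebesgue_density (wild_sum p)"
proof -
  have "absolutely_continuous lborel f\<^sub>0"
    using assms by (simp add: has_lebesgue_density_iff[OF real_distribution.events_eq_borel[OF f0]])
  then have "absolutely_continuous lborel (wild_sum p)"
    unfolding wild_sum_def
    by (intro absolutely_continuous_mixture real_distribution_wild absolutely_continuous_wild) auto
  then show ?thesis
    by (simp add: has_lebesgue_density_iff[OF real_distribution.events_eq_borel[OF real_distribution_wild_sum]])
qed

lemma abs_moment_mean_collision_le:
  assumes r: "0 \<le> r" and f: "real_distribution f" and g: "real_distribution g"
  shows "abs_moment r (mean_collision f g) \<le>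
    ennreal (2 powr r) * (abs_moment r f + abs_moment r g + abs_moment r (gaussian T))" (is "_ \<le> ?X")
proof -
  have "abs_moment r (collision f g) \<le> ?X"
    by (rule order_trans[OF abs_moment_collision_le[OF r f g]], rule mult_left_mono) auto
  moreover have "abs_moment r (collision f (gaussian T)) \<le> ?X"
    by (rule order_trans[OF abs_moment_collision_le[OF r f real_distribution_gaussian[OF T]]],
        intro mult_left_mono add_right_mono) auto
  ultimately have "abs_moment r (mean_collision f g) \<le> ennreal (2 * lam / rate) * ?X + ennreal (mu / rate) * ?X"
    unfolding abs_moment_def
    by (subst nn_integral_mean_collision[OF f g]) (auto intro!: add_mono mult_left_mono)
  also have "\<dots> = (ennreal (2 * lam / rate) + ennreal (mu / rate)) * ?X"
    by (simp add: distrib_right)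
  also have "ennreal (2 * lam / rate) + ennreal (mu / rate) = 1"
    using lam mu by (subst ennreal_plus[symmetric]) (auto simp: add_divide_distrib[symmetric])
  finally show ?thesis by simp
qed

text \<open>
  The choice of binomial coefficients as growth rate turns averaging over \<open>{..n}\<close>, by the hockey-stick
  identity, into a division by \<open>K + 1\<close>, which beats the constant of the collision estimate
  once \<open>K\<close> is large.
\<close>

lemma abs_moment_wild_le:
  assumes r: "0 \<le> r" and fin: "abs_moment r f\<^sub>0 < \<infinity>"
  obtains M K where "0 \<le> M" "\<And>n. abs_moment r (wild n) \<le> ennreal (M * real (n + K choose K))"
proof -
  define C where "C = 2 powr r"
  obtain G where G: "abs_moment r (gaussian T) = ennreal G" "0 \<le> G"
    using abs_moment_gaussian_finite[OF r T] by (cases "abs_moment r (gaussian T)") auto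
  obtain m where m: "abs_moment r f\<^sub>0 = ennreal m" "0 \<le> m"
    using fin by (cases "abs_moment r f\<^sub>0") auto
  \<comment> \<open>The budget \<open>M * ?b (Suc N)\<close> is split in halves:
    \<open>4 * C \<le> K\<close> makes the two moment sums fit into one half, and
    \<open>2 * (C * G) \<le> M\<close> fits the thermostat into the other. The term \<open>m\<close>
    in \<open>M\<close> covers \<open>n = 0\<close>.\<close>
  define K where "K = nat \<lceil>4 * C\<rceil>"
  define M where "M = max m (2 * (C * G))"
  have K: "4 * C \<le> real K" by (simp add: K_def real_nat_ceiling_ge)
  have C: "0 \<le> C" by (simp add: C_def)
  have M: "m \<le> M" "2 * (C * G) \<le> M" "0 \<le> M" using m by (auto simp: M_def)
  let ?b = "\<lambda>n. real (n + K choose K)"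
  have "abs_moment r (wild n) \<le> ennreal (M * ?b n)" for n
  proof (induction n rule: less_induct)
    case (less n)
    show ?case
    proof (cases n)
      case 0
      then show ?thesis using m M by (simp add: ennreal_leI)
    next
      case (Suc N)
      have mc: "abs_moment r (mean_collision (wild k) (wild (N - k))) \<le>
          ennreal (C * (M * ?b k + M * ?b (N - k) + G))" if "k \<le> N" for k
      proof -
        have "abs_moment r (mean_collision (wild k) (wild (N - k))) \<le>
            ennreal C * (abs_moment r (wild k) + abs_moment r (wild (N - k)) + ennreal G)"
          unfolding C_def G(1)[symmetric]
          by (rule abs_moment_mean_collision_le[OF r real_distribution_wild real_distribution_wild])
        also have "\<dots> \<le> ennreal C * (ennreal (M * ?b k) + ennreal (M * ?b (N - k)) + ennreal G)"
          using less[of k] less[of "N - k"] that Suc by (intro mult_left_mono add_mono) auto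
        also have "\<dots> = ennreal (C * (M * ?b k + M * ?b (N - k) + G))"
          using M C G by (simp add: ennreal_mult)
        finally show ?thesis .
      qed
      have flip: "(\<Sum>k\<le>N. ?b (N - k)) = (\<Sum>k\<le>N. ?b k)"
        using sum.nat_diff_reindex[of ?b "Suc N"] by (simp add: lessThan_Suc_atMost)
      \<comment> \<open>The average of the bounds over \<open>k \<le> N\<close> is thus the next
        bound divided by \<open>Suc K\<close>.\<close>
      have hockey: "real (Suc K) * (\<Sum>k\<le>N. ?b k) = real (Suc N) * ?b (Suc N)"
      proof -
        have "(\<Sum>k\<le>N. (k + K choose K)) = (Suc (N + K) choose Suc K)"
          using sum_choose_lower[of K N] binomial_symmetric[of N "Suc (N + K)"]
          by (simp add: ac_simps binomial_symmetric[of K "_ + K"])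
        then show ?thesis
          unfolding of_nat_sum[symmetric] of_nat_mult[symmetric] Suc_times_choose_shift by simp
      qed
      have half1: "2 * C * M * (\<Sum>k\<le>N. ?b k) \<le> real (Suc N) * (M * ?b (Suc N) / 2)"
      proof -
        have "4 * C * (\<Sum>k\<le>N. ?b k) \<le> real (Suc K) * (\<Sum>k\<le>N. ?b k)"
          using K by (intro mult_right_mono sum_nonneg) auto
        then have "M * (4 * C * (\<Sum>k\<le>N. ?b k)) \<le> M * (real (Suc N) * ?b (Suc N))"
          unfolding hockey by (intro mult_left_mono M(3))
        then show ?thesis by (simp add: algebra_simps)
      qed
      have half2: "C * G \<le> M * ?b (Suc N) / 2"
      proof -
        have "1 \<le> ?b (Suc N)"
          by (simp add: Suc_leI zero_less_binomial)
        then have "M * 1 \<le> M * ?b (Suc N)"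
          using M(3) by (rule mult_left_mono)
        then show ?thesis using M(2) by linarith
      qed
      have "(\<Sum>k\<le>N. C * (M * ?b k + M * ?b (N - k) + G)) =
          2 * C * M * (\<Sum>k\<le>N. ?b k) + real (Suc N) * (C * G)"
        by (simp only: distrib_left sum.distrib sum_distrib_left[symmetric] flip) simp
      also have "\<dots> \<le> real (Suc N) * (M * ?b (Suc N) / 2) + real (Suc N) * (M * ?b (Suc N) / 2)"
        by (intro add_mono half1 mult_left_mono[OF half2]) simp
      also have "\<dots> = real (Suc N) * (M * ?b (Suc N))"
        by (simp only: distrib_left[symmetric] field_sum_of_halves)
      finally have sum: "(\<Sum>k\<le>N. C * (M * ?b k + M * ?b (N - k) + G)) \<le> real (Suc N) * (M * ?b (Suc N))" .
      have "abs_moment r (wild n) =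
          (\<Sum>k\<le>N. abs_moment r (mean_collision (wild k) (wild (N - k)))) / ennreal (real (Suc N))"
        unfolding Suc abs_moment_def by (rule nn_integral_wild_Suc) simp
      also have "\<dots> \<le> (\<Sum>k\<le>N. ennreal (C * (M * ?b k + M * ?b (N - k) + G))) / ennreal (real (Suc N))"
        using mc by (intro divide_right_mono_ennreal sum_mono) auto
      also have "\<dots> = ennreal ((\<Sum>k\<le>N. C * (M * ?b k + M * ?b (N - k) + G)) / real (Suc N))"
        using C M G by (subst sum_ennreal) (auto simp: divide_ennreal sum_nonneg simp del: of_nat_Suc)
      also have "\<dots> \<le> ennreal (M * ?b n)"
        using sum unfolding Suc by (intro ennreal_leI) (simp add: divide_le_eq ac_simps del: of_nat_Suc)
      finally show ?thesis .
    qed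
  qed
  with M(3) show thesis by (rule that)
qed

text \<open>The moment of a mixture is the weighted sum of moments; the geometric weights have ratio
  \<open>1 - p < 1\<close> and beat the binomial growth.\<close>

lemma finite_moment_wild_sum:
  assumes r: "0 \<le> r" and fin: "finite_moment r f\<^sub>0" and p: "0 < p" "p \<le> 1"
  shows "finite_moment r (wild_sum p)"
proof -
  have "abs_moment r f\<^sub>0 < \<infinity>"
    using fin finite_moment_iff[OF real_distribution.events_eq_borel[OF f0]] by simp
  then obtain M K where M: "0 \<le> M" and mom: "\<And>n. abs_moment r (wild n) \<le> ennreal (M * real (n + K choose K))"
    using abs_moment_wild_le[OF r] by blast
  let ?a = "\<lambda>n. p * M * (real (n + K choose K) * (1 - p) ^ n)"
  have "abs_moment r (wild_sum p) = (\<Sum>n. ennreal ((1 - p) ^ n * p) * abs_moment r (wild n))"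
    unfolding abs_moment_def wild_sum_def using p
    by (subst nn_integral_mixture) (auto simp: real_distribution_wild nn_integral_nat_pmf pmf_geometric)
  also have "\<dots> \<le> (\<Sum>n. ennreal ((1 - p) ^ n * p) * ennreal (M * real (n + K choose K)))"
    by (intro suminf_le mult_left_mono mom) auto
  also have "\<dots> = (\<Sum>n. ennreal (?a n))"
    using p M by (intro suminf_cong, subst ennreal_mult[symmetric]) (simp_all add: mult_ac)
  also have "\<dots> < \<infinity>"
  proof -
    have "summable ?a"
      using p by (intro summable_mult summable_choose_power) auto
    then show ?thesis
      using p M by (subst suminf_ennreal2) auto
  qed
  finally show ?thesis
    using finite_moment_iff[OF real_distribution.events_eq_borel[OF real_distribution_wild_sum]] by simp
qed

end

section \<open>Assembly of existence, uniqueness and propagation\<close>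

theorem theorem5:
  fixes lam mu T :: real and f\<^sub>0 :: "real measure"
  assumes "lam > 0" "mu > 0" "T > 0"
    and "real_distribution f\<^sub>0"
  shows "(\<exists>!f. f \<in> tv_continuous_curves \<and> mild_solution lam mu T f\<^sub>0 f) \<and>
    (\<forall>f. f \<in> tv_continuous_curves \<and> mild_solution lam mu T f\<^sub>0 f \<longrightarrow>
       (\<forall>t\<ge>0. real_distribution (f t)) \<and>
       (has_lebesgue_density f\<^sub>0 \<longrightarrow> (\<forall>t\<ge>0. has_lebesgue_density (f t))) \<and>
       (\<forall>r\<ge>2. finite_moment r f\<^sub>0 \<longrightarrow> (\<forall>t\<ge>0. finite_moment r (f t))))"
proof -
  interpret thermostated_kac lam mu T f\<^sub>0
    using assms by (rule thermostated_kac.intro)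
  have unique: "f = solution" if "f \<in> tv_continuous_curves \<and> mild_solution lam mu T f\<^sub>0 f" for f
    using that mild_solution_eq_solution by blast
  show ?thesis
  proof (rule conjI)
    show "\<exists>!f. f \<in> tv_continuous_curves \<and> mild_solution lam mu T f\<^sub>0 f"
      by (rule ex1I[of _ solution])
         (use solution_in_tv_continuous_curves mild_solution_solution unique in blast)+
    have "real_distribution (solution t)" if "0 \<le> t" for t
      using that by (simp add: solution_def real_distribution_wild_sum)
    moreover have "has_lebesgue_density (solution t)" if "has_lebesgue_density f\<^sub>0" "0 \<le> t" for t
      using that by (simp add: solution_def has_lebesgue_density_wild_sum)
    moreover have "finite_moment r (solution t)" if "2 \<le> r" "finite_moment r f\<^sub>0" "0 \<le> t" for r t
      using finite_moment_wild_sum[OF _ that(2) _ exp_rate_le_1[OF that(3)]] that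
      by (simp add: solution_def)
    ultimately have "(\<forall>t\<ge>0. real_distribution (solution t)) \<and>
       (has_lebesgue_density f\<^sub>0 \<longrightarrow> (\<forall>t\<ge>0. has_lebesgue_density (solution t))) \<and>
       (\<forall>r\<ge>2. finite_moment r f\<^sub>0 \<longrightarrow> (\<forall>t\<ge>0. finite_moment r (solution t)))"
      by simp
    with unique show "\<forall>f. f \<in> tv_continuous_curves \<and> mild_solution lam mu T f\<^sub>0 f \<longrightarrow>
       (\<forall>t\<ge>0. real_distribution (f t)) \<and>
       (has_lebesgue_density f\<^sub>0 \<longrightarrow> (\<forall>t\<ge>0. has_lebesgue_density (f t))) \<and>
       (\<forall>r\<ge>2. finite_moment r f\<^sub>0 \<longrightarrow> (\<forall>t\<ge>0. finite_moment r (f t)))"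
      by metis
  qed
qed

end
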